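(* Let $\mathcal{M}=\{\mathbb{M}^{(p)}:p>0\}$ be a weight matrix and let $\alpha>1$. Suppose that for each $p>0$ there exists some $\alpha_p>\alpha$ such that $\overline{\mathbb{G}}^{1-\alpha_p}\mathbb{M}^{(p)}=(j^{(1-\alpha_p)j}M^{(p)}_j)_{j\in\mathbb{N}_0}$ is equivalent to a log-convex sequence $\mathbb{L}^{(p)}$ (depending on $\alpha_p$). Then the following assertions are equivalent: (a) The matrix $\mathcal{M}$ satisfies $(\mathcal{M}_{\{\mathrm{rai}\}})$. (b) The class $\mathcal{A}_{\{\mathcal{M}\}}(S_\alpha)$ is holomorphically closed. (c) The class $\mathcal{A}_{\{\mathcal{M}\}}(S_\alpha)$ is inverse-closed. If in addition $\mathcal{M}$ satisfies $(\mathcal{M}_{\{C^\omega\}})$ and $(\mathcal{M}_{\{\mathrm{dc}\}})$, then (a), (b), (c) are also equivalent to each of: (d) The class $\mathcal{A}_{\{\mathcal{M}\}}(S_\alpha)$ is closed under composition. (e) The matrix $\mathcal{M}$ satisfies $(\mathcal{M}_{\{\mathrm{FdB}\}})$.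
   Context: $\mathbb{N}_0=\{0,1,2,\dots\}$, $\mathbb{N}=\{1,2,\dots\}$, $0^0:=1$. A weight matrix is a family $\mathcal{M}=\{\mathbb{M}^{(p)}=(M^{(p)}_j)_{j\in\mathbb{N}_0}:p>0\}$ of sequences of positive reals with $M^{(p)}_0=1$ for all $p$ and $M^{(p)}_j\le M^{(q)}_j$ for all $j$ whenever $p\le q$. Write $\check M^{(p)}_j:=M^{(p)}_j/j!$. For $a\in\mathbb{R}$, $\overline{\mathbb{G}}^a:=(j^{ja})_{j\in\mathbb{N}_0}$; products of sequences are termwise. A (positive) sequence is log-convex, (lc), if $M_j^2\le M_{j-1}M_{j+1}$ for all $j\ge1$. For sequences, $\mathbb{M}\preceq\mathbb{L}$ means there are $A,B>0$ with $M_j\le AB^jL_j$ for all $j\in\mathbb{N}_0$; $\mathbb{M}$ and $\mathbb{L}$ are equivalent if $\mathbb{M}\preceq\mathbb{L}$ and $\mathbb{L}\preceq\mathbb{M}$. Conditions on a weight matrix $\mathcal{M}$ (indices in $(0,\infty)$): - $(\mathcal{M}_{\{C^\omega\}})$: there is $p$ with $\liminf_{j\to\infty}(\check M^{(p)}_j)^{1/j}>0$. - $(\mathcal{M}_{\{\mathrm{rai}\}})$: $\forall p\ \exists C>0\ \exists q\ \forall 1\le j\le k$: $(\check M^{(p)}_j)^{1/j}\le C(\check M^{(q)}_k)^{1/k}$. - $(\mathcal{M}_{\{\mathrm{dc}\}})$: $\forall p\ \exists C>0\ \exists q\ \forall j\in\mathbb{N}_0$: $M^{(p)}_{j+1}\le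 C^{j+1}M^{(q)}_j$. - $(\mathcal{M}_{\{\mathrm{FdB}\}})$: $\forall p\ \exists q$: $(\check{\mathbb{M}}^{(p)})^\circ\preceq\check{\mathbb{M}}^{(q)}$, where for a sequence $\check{\mathbb{M}}$ one sets $\check M^\circ_0:=1$ and $\check M^\circ_k:=\max\{\check M_\ell\check M_{j_1}\cdots\check M_{j_\ell}: \ell\in\mathbb{N},\ j_i\in\mathbb{N},\ \sum_{i=1}^\ell j_i=k\}$ for $k\ge1$. Sectors: $\mathcal{R}$ is the Riemann surface of the logarithm and, for $\alpha>0$, $S_\alpha:=\{z\in\mathcal{R}:|\arg z|<\alpha\pi/2\}$; derivatives of functions on $S_\alpha$ are taken with respect to the coordinate $z$. $\mathcal{H}(\cdot)$ denotes holomorphic functions. For a positive sequence $\mathbb{M}$, $\mathcal{A}_{\{\mathbb{M}\}}(S)$ is the set of $f\in\mathcal{H}(S)$ for which there is $h>0$ with $\sup_{z\in S,j\in\mathbb{N}_0}\frac{|f^{(j)}(z)|}{h^jM_j}<\infty$, and $\mathcal{A}_{\{\mathcal{M}\}}(S):=\bigcup_{p>0}\mathcal{A}_{\{\mathbb{M}^{(p)}\}}(S)$. For $U\subseteq\mathbb{C}$ open, $\mathcal{H}_{\{\mathcal{M}\}}(U)$ is the set of $g\in\mathcal{H}(U)$ such that for each compact $K\subset U$ there are $p,h>0$ with $\sup_{z\in K,j\in\mathbb{N}_0}\frac{|g^{(j)}(z)|}{h^jM^{(p)}_j}<\infty$. The class $\mathcal{A}_{\{\mathcal{M}\}}(S_\alpha)$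 is: - holomorphically closed if $g\circ f\in\mathcal{A}_{\{\mathcal{M}\}}(S_\alpha)$ for all $f\in\mathcal{A}_{\{\mathcal{M}\}}(S_\alpha)$ and all $g\in\mathcal{H}(U)$ with $U\subseteq\mathbb{C}$ open containing the closure of the range of $f$; - inverse-closed if $1/f\in\mathcal{A}_{\{\mathcal{M}\}}(S_\alpha)$ for all $f\in\mathcal{A}_{\{\mathcal{M}\}}(S_\alpha)$ with $\inf_{z\in S_\alpha}|f(z)|>0$; - closed under composition if $g\circ f\in\mathcal{A}_{\{\mathcal{M}\}}(S_\alpha)$ for all $f\in\mathcal{A}_{\{\mathcal{M}\}}(S_\alpha)$ and all $g\in\mathcal{H}_{\{\mathcal{M}\}}(U)$ with $U\subseteq\mathbb{C}$ open containing the closure of the range of $f$. *)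

theory Defs
  imports "HOL-Complex_Analysis.Complex_Analysis"
begin

section \<open>Sequences and weight matrices\<close>

text \<open>A weight matrix is a family \<open>M p\<close> of sequences, where only indices \<open>p > 0\<close> are relevant.\<close>

definition weight_matrix :: "(real \<Rightarrow> nat \<Rightarrow> real) \<Rightarrow> bool" where
  "weight_matrix M \<longleftrightarrow>
     (\<forall>p>0. M p 0 = 1 \<and> (\<forall>j. M p j > 0)) \<and>
     (\<forall>p>0. \<forall>q\<ge>p. \<forall>j. M p j \<le> M q j)"

definition check_seq :: "(nat \<Rightarrow> real) \<Rightarrow> nat \<Rightarrow> real" where
  "check_seq m j = m j / fact j"

text \<open>The sequence \<open>j\<close> to the power \<open>j a\<close>. The case \<open>j = 0\<close> is singled out because
  \<open>0 powr 0 = 0\<close> in the library, whereas the convention here is \<open>0\<^sup>0 = 1\<close>.\<close>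

definition gevrey_seq :: "real \<Rightarrow> nat \<Rightarrow> real" where
  "gevrey_seq a j = (if j = 0 then 1 else real j powr (real j * a))"

definition log_convex_seq :: "(nat \<Rightarrow> real) \<Rightarrow> bool" where
  "log_convex_seq m \<longleftrightarrow> (\<forall>j. m j > 0) \<and> (\<forall>j\<ge>1. (m j)\<^sup>2 \<le> m (j - 1) * m (j + 1))"

definition seq_preceq :: "(nat \<Rightarrow> real) \<Rightarrow> (nat \<Rightarrow> real) \<Rightarrow> bool" where
  "seq_preceq m l \<longleftrightarrow> (\<exists>A>0. \<exists>B>0. \<forall>j. m j \<le> A * B ^ j * l j)"

definition seq_equiv :: "(nat \<Rightarrow> real) \<Rightarrow> (nat \<Rightarrow> real) \<Rightarrow> bool" where
  "seq_equiv m l \<longleftrightarrow> seq_preceq m l \<and> seq_preceq l m"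

definition circ_products :: "(nat \<Rightarrow> real) \<Rightarrow> nat \<Rightarrow> real set" where
  "circ_products m k =
     {m (length js) * prod_list (map m js) |js.
        js \<noteq> [] \<and> (\<forall>i\<in>set js. i \<ge> 1) \<and> sum_list js = k}"

definition circ_seq :: "(nat \<Rightarrow> real) \<Rightarrow> nat \<Rightarrow> real" where
  "circ_seq m k = (if k = 0 then 1 else Max (circ_products m k))"

text \<open>The maximum above is over a finite nonempty set.\<close>

lemma finite_circ_products: "finite (circ_products m k)"
proof -
  have len: "length js \<le> sum_list js" if "\<forall>i\<in>set js. i \<ge> 1" for js :: "nat list"
    using that by (induction js) auto
  have "{js. js \<noteq> [] \<and> (\<forall>i\<in>set js. i \<ge> 1) \<and> sum_list js = k}
          \<subseteq> {js. set js \<subseteq> {..k} \<and> length js \<le> k}"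
    using len by (auto intro: member_le_sum_list)
  then have "finite {js. js \<noteq> [] \<and> (\<forall>i\<in>set js. i \<ge> 1) \<and> sum_list js = k}"
    by (rule finite_subset) (simp add: finite_lists_length_le)
  then show ?thesis
    unfolding circ_products_def by simp
qed

lemma circ_products_nonempty: "k \<ge> 1 \<Longrightarrow> circ_products m k \<noteq> {}"
  unfolding circ_products_def by (auto intro!: exI[of _ "[k]"])

definition matrix_Comega :: "(real \<Rightarrow> nat \<Rightarrow> real) \<Rightarrow> bool" where
  "matrix_Comega M \<longleftrightarrow> (\<exists>p>0. liminf (\<lambda>j. ereal (root j (check_seq (M p) j))) > 0)"

definition matrix_rai :: "(real \<Rightarrow> nat \<Rightarrow> real) \<Rightarrow> bool" where
  "matrix_rai M \<longleftrightarrow>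
     (\<forall>p>0. \<exists>C>0. \<exists>q>0. \<forall>j k. 1 \<le> j \<and> j \<le> k \<longrightarrow>
        root j (check_seq (M p) j) \<le> C * root k (check_seq (M q) k))"

definition matrix_dc :: "(real \<Rightarrow> nat \<Rightarrow> real) \<Rightarrow> bool" where
  "matrix_dc M \<longleftrightarrow> (\<forall>p>0. \<exists>C>0. \<exists>q>0. \<forall>j. M p (j + 1) \<le> C ^ (j + 1) * M q j)"

definition matrix_FdB :: "(real \<Rightarrow> nat \<Rightarrow> real) \<Rightarrow> bool" where
  "matrix_FdB M \<longleftrightarrow>
     (\<forall>p>0. \<exists>q>0. seq_preceq (circ_seq (check_seq (M p))) (check_seq (M q)))"


section \<open>Sectors on the Riemann surface of the logarithm\<close>

text \<open>The Riemann surface of the logarithm is the universal covering of the punctured plane. It is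
  represented by its global holomorphic chart \<open>log\<close>: the complex number \<open>w\<close> stands for the point
  of modulus \<open>exp (Re w)\<close> and (unreduced) argument \<open>Im w\<close>, and the coordinate \<open>z\<close> is the covering
  map \<open>exp\<close>. Since \<open>log\<close> is a biholomorphic chart, a function is holomorphic on an open subset of
  the surface iff it is \<open>holomorphic_on\<close> the corresponding set of logarithms.\<close>

type_synonym log_surface = complex

definition sector :: "real \<Rightarrow> log_surface set" where
  "sector \<alpha> = {w. \<bar>Im w\<bar> < \<alpha> * pi / 2}"

text \<open>The complex derivative with respect to the coordinate \<open>z = exp w\<close>.\<close>

definition zderiv :: "(log_surface \<Rightarrow> complex) \<Rightarrow> log_surface \<Rightarrow> complex" where
  "zderiv f w = Lim (at w) (\<lambda>v. (f v - f w) / (exp v - exp w))"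

lemma zderiv_eq:
  assumes "f field_differentiable (at w)"
  shows "zderiv f w = deriv f w / exp w"
proof -
  have f: "((\<lambda>v. (f v - f w) / (v - w)) \<longlongrightarrow> deriv f w) (at w)"
    using assms DERIV_deriv_iff_field_differentiable has_field_derivative_iff by blast
  have e: "((\<lambda>v. (exp v - exp w) / (v - w)) \<longlongrightarrow> exp w) (at w)"
    using DERIV_exp[of w] by (simp add: has_field_derivative_iff)
  have "((\<lambda>v. ((f v - f w) / (v - w)) / ((exp v - exp w) / (v - w))) \<longlongrightarrow> deriv f w / exp w) (at w)"
    by (rule tendsto_divide[OF f e]) simp
  moreover have "\<forall>\<^sub>F v in at w. ((f v - f w) / (v - w)) / ((exp v - exp w) / (v - w))
                     = (f v - f w) / (exp v - exp w)"
    by (auto simp: eventually_at_filter)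
  ultimately have "((\<lambda>v. (f v - f w) / (exp v - exp w)) \<longlongrightarrow> deriv f w / exp w) (at w)"
    by (rule Lim_transform_eventually)
  then show ?thesis
    unfolding zderiv_def by (intro tendsto_Lim) auto
qed

text \<open>For a function that descends to the plane, this is the usual derivative.\<close>

lemma zderiv_pullback:
  assumes "g field_differentiable (at (exp w))"
  shows "zderiv (\<lambda>w. g (exp w)) w = deriv g (exp w)"
proof -
  have "((\<lambda>w. g (exp w)) has_field_derivative deriv g (exp w) * exp w) (at w)"
    using assms DERIV_chain2[OF _ DERIV_exp] DERIV_deriv_iff_field_differentiable by blast
  then show ?thesis
    using zderiv_eq DERIV_imp_deriv field_differentiable_def by fastforce
qed


section \<open>Ultraholomorphic classes and stability properties\<close>

definition ultraholo_seq :: "(nat \<Rightarrow> real) \<Rightarrow> log_surface set \<Rightarrow> (log_surface \<Rightarrow> complex) set" where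
  "ultraholo_seq m S = {f. f holomorphic_on S \<and>
     (\<exists>h>0. bdd_above ((\<lambda>(w, j). norm ((zderiv ^^ j) f w) / (h ^ j * m j)) ` (S \<times> UNIV)))}"

definition ultraholo ::
    "(real \<Rightarrow> nat \<Rightarrow> real) \<Rightarrow> log_surface set \<Rightarrow> (log_surface \<Rightarrow> complex) set" where
  "ultraholo M S = (\<Union>p\<in>{0<..}. ultraholo_seq (M p) S)"

definition local_class :: "(real \<Rightarrow> nat \<Rightarrow> real) \<Rightarrow> complex set \<Rightarrow> (complex \<Rightarrow> complex) set" where
  "local_class M U = {g. g holomorphic_on U \<and>
     (\<forall>K. compact K \<and> K \<subseteq> U \<longrightarrow> (\<exists>p>0. \<exists>h>0.
        bdd_above ((\<lambda>(z, j). norm ((deriv ^^ j) g z) / (h ^ j * M p j)) ` (K \<times> UNIV))))}"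

definition holomorphically_closed :: "(real \<Rightarrow> nat \<Rightarrow> real) \<Rightarrow> log_surface set \<Rightarrow> bool" where
  "holomorphically_closed M S \<longleftrightarrow>
     (\<forall>f\<in>ultraholo M S. \<forall>U g. open U \<and> closure (f ` S) \<subseteq> U \<and> g holomorphic_on U
        \<longrightarrow> g \<circ> f \<in> ultraholo M S)"

definition inverse_closed :: "(real \<Rightarrow> nat \<Rightarrow> real) \<Rightarrow> log_surface set \<Rightarrow> bool" where
  "inverse_closed M S \<longleftrightarrow>
     (\<forall>f\<in>ultraholo M S. (INF w\<in>S. norm (f w)) > 0 \<longrightarrow> (\<lambda>w. 1 / f w) \<in> ultraholo M S)"

definition composition_closed :: "(real \<Rightarrow> nat \<Rightarrow> real) \<Rightarrow> log_surface set \<Rightarrow> bool" where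
  "composition_closed M S \<longleftrightarrow>
     (\<forall>f\<in>ultraholo M S. \<forall>U. \<forall>g\<in>local_class M U. open U \<and> closure (f ` S) \<subseteq> U
        \<longrightarrow> g \<circ> f \<in> ultraholo M S)"

end

(* The implication from inverse-closedness to (rai) rests on completely monotone functions. With
   g = alpha_p - 1 > alpha - 1, the Laplace transform of exp (- s powr (1/g)) extends to the sector by
   rotating the ray of integration, has all derivatives bounded there by those of Gevrey order g, and
   is completely monotone on the positive axis. A weighted superposition of its dilates upgrades this
   to the size j^(j g) L_j ~ M^(p)_j. If f is such a function and C > sup |f|, then up to the signs
   (-1)^k the Taylor coefficients r_k of 1 / (C - f) at positive points satisfy
   D r_k = sum a_j r_(k-j) with a_j >= 0, so r_(j l) dominates a_j^l, and membership of 1 / (C - f) in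
   the class yields (check M^(p)_j)^l <= K^(j l) check M^(q)_(j l). Since (M^(q)_k)^(1/k) is almost
   increasing, multiples j l can be replaced by arbitrary k >= j, which is (rai). The remaining
   implications follow from estimating compositions of Taylor series. *)

theory Submission
  imports Defs "HOL-Probability.Sinc_Integral" "HOL-Real_Asymp.Real_Asymp"
begin

section \<open>Taylor jets with respect to the coordinate on the sector\<close>

text \<open>The growth is produced in two stages because the two factors have different origins. On
  a sector of opening \<alpha> > 1 the ray of integration has to turn by up to (\<alpha> - 1) pi /
  2, and exp (- s powr \<kappa>) keeps decaying at all these angles when \<kappa> (\<alpha> - 1) <
  1. For \<kappa> = 1 / (alpha_p - 1) this is the hypothesis alpha_p > \<alpha>, and the moments of
  the kernel supply exactly the factor j^(j (alpha_p - 1)) that the hypothesis divides out of M^(p).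
  The factor that remains is log-convex, which is what a superposition of dilates can reproduce. No
  single positive point has to show the growth of all derivatives: each order j may have its own
  point, because membership of 1 / (C - f) in the class is a bound uniform on the sector. Concerning
  (d) and (e), (C^omega) places every holomorphic function in the local class, and (dc) pays for the
  outer factor of the Faa di Bruno products, a factor that Cauchy estimates do not produce.\<close>

lemma sector_iff: "w \<in> sector \<alpha> \<longleftrightarrow> \<bar>Im w\<bar> < \<alpha> * pi / 2"
  by (simp add: sector_def)

lemma open_sector: "open (sector \<alpha>)"
proof -
  have "sector \<alpha> = Im -` {- (\<alpha> * pi / 2) <..< \<alpha> * pi / 2}"
    by (auto simp: sector_def)
  moreover have "open (Im -` {- (\<alpha> * pi / 2) <..< \<alpha> * pi / 2})"
    by (intro open_vimage continuous_intros open_greaterThanLessThan)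
  ultimately show ?thesis by simp
qed

lemma of_real_in_sector: "\<alpha> > 0 \<Longrightarrow> of_real x \<in> sector \<alpha>"
  by (simp add: sector_def)

lemma zderiv_holomorphic_eq:
  assumes "f holomorphic_on S" "open S" "w \<in> S"
  shows "zderiv f w = deriv f w / exp w"
  using assms by (intro zderiv_eq) (auto intro: holomorphic_on_imp_differentiable_at)

lemma zderiv_holomorphic:
  assumes "f holomorphic_on S" "open S"
  shows "zderiv f holomorphic_on S"
proof -
  have "(\<lambda>w. deriv f w / exp w) holomorphic_on S"
    using assms by (intro holomorphic_intros) auto
  then show ?thesis
    using zderiv_holomorphic_eq[OF assms] by (simp cong: holomorphic_cong)
qed

lemma zderiv_funpow_holomorphic:
  assumes "f holomorphic_on S" "open S"
  shows "(zderiv ^^ n) f holomorphic_on S"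
  by (induction n) (use assms in \<open>auto intro: zderiv_holomorphic\<close>)

text \<open>The factor \<open>exp w\<close> is dz/dw, so functions linked by this rule are
  successive coordinate derivatives. Constructed series and constants are differentiated in this
  way.\<close>

lemma zderiv_funpow_eqI:
  assumes "open S" "\<And>w. w \<in> S \<Longrightarrow> F 0 w = f w"
    and "\<And>n w. w \<in> S \<Longrightarrow> (F n has_field_derivative exp w * F (Suc n) w) (at w)"
    and "w \<in> S"
  shows "(zderiv ^^ n) f w = F n w"
  using assms(4)
proof (induction n arbitrary: w)
  case 0
  then show ?case using assms(2) by simp
next
  case (Suc n)
  have "((zderiv ^^ n) f has_field_derivative exp w * F (Suc n) w) (at w)"
    by (rule has_field_derivative_transform_within_open[OF assms(3)[OF Suc.prems] assms(1) Suc.prems])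
       (simp add: Suc.IH)
  then have "zderiv ((zderiv ^^ n) f) w = exp w * F (Suc n) w / exp w"
    by (subst zderiv_eq) (auto simp: DERIV_imp_deriv field_differentiable_def)
  then show ?case by simp
qed

text \<open>\<open>\<lambda>x. w + Ln (1 + x / exp w)\<close> is the inverse, near \<open>w\<close>, of the coordinate \<open>v \<mapsto> exp v - exp w\<close>.\<close>

definition jet :: "(complex \<Rightarrow> complex) \<Rightarrow> complex \<Rightarrow> complex fps" where
  "jet f w = Abs_fps (\<lambda>n. (zderiv ^^ n) f w / fact n)"

lemma jet_nth: "jet f w $ n = (zderiv ^^ n) f w / fact n"
  by (simp add: jet_def)

text \<open>In the coordinate x = z - exp w the operator \<open>zderiv\<close> is the ordinary
  derivative, so \<open>jet\<close> is an ordinary Taylor series. Product and chain rules on the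
  surface thereby become multiplication and substitution of formal power series.\<close>

lemma has_fps_expansion_jet:
  assumes f: "f holomorphic_on S" and S: "open S" and w: "w \<in> S"
  shows "(\<lambda>x. f (w + Ln (1 + x / exp w))) has_fps_expansion jet f w"
proof -
  define l where "l = (\<lambda>x. w + Ln (1 + x / exp w))"
  \<comment> \<open>The ball keeps \<open>1 + x / exp w\<close> off the cut of \<open>Ln\<close>;
    the second condition keeps \<open>l x\<close> inside \<open>S\<close>.\<close>
  define T where "T = {x \<in> ball 0 (norm (exp w)). l x \<in> S}"
  have ball: "1 + x / exp w \<notin> \<real>\<^sub>\<le>\<^sub>0" if "x \<in> ball 0 (norm (exp w))" for x
  proof -
    have "norm (x / exp w) < 1" using that by (simp add: norm_divide divide_simps)
    then have "Re (x / exp w) > -1" using abs_Re_le_cmod[of "x / exp w"] by linarith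
    then show ?thesis by (auto simp: complex_nonpos_Reals_iff)
  qed
  have exp_l: "exp (l x) = exp w + x" if "x \<in> ball 0 (norm (exp w))" for x
  proof -
    have "1 + x / exp w \<noteq> 0" using ball[OF that] by auto
    then show ?thesis by (simp add: l_def exp_add field_simps)
  qed
  have dl: "(l has_field_derivative 1 / exp (l x)) (at x)" if "x \<in> ball 0 (norm (exp w))" for x
  proof -
    have nz: "1 + x / exp w \<noteq> 0" using ball[OF that] by auto
    have "(l has_field_derivative inverse (1 + x / exp w) * (1 / exp w)) (at x)"
      unfolding l_def by (auto intro!: derivative_eq_intros ball[OF that])
    moreover have "inverse (1 + x / exp w) * (1 / exp w) = 1 / exp (l x)"
      using nz exp_l[OF that] by (simp add: field_simps)
    ultimately show ?thesis by simp
  qed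
  have hl: "l holomorphic_on ball 0 (norm (exp w))"
    using dl holomorphic_on_def field_differentiable_def has_field_derivative_at_within by blast
  have "T = ball 0 (norm (exp w)) \<inter> l -` S" by (auto simp: T_def)
  then have oT: "open T"
    using hl S by (metis continuous_on_open_vimage holomorphic_on_imp_continuous_on open_ball Int_commute)
  have T0: "0 \<in> T" using w by (simp add: T_def l_def)
  have der: "(deriv ^^ n) (\<lambda>x. f (l x)) x = (zderiv ^^ n) f (l x)" if "x \<in> T" for x n
    using that
  proof (induction n arbitrary: x)
    case (Suc n)
    have x: "x \<in> ball 0 (norm (exp w))" "l x \<in> S" using Suc.prems by (auto simp: T_def)
    have hz: "(zderiv ^^ n) f holomorphic_on S" by (rule zderiv_funpow_holomorphic[OF f S])
    then have "((zderiv ^^ n) f has_field_derivative deriv ((zderiv ^^ n) f) (l x)) (at (l x))"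
      using S x holomorphic_derivI by blast
    from DERIV_chain2[OF this dl[OF x(1)]]
    have "((\<lambda>x. (zderiv ^^ n) f (l x)) has_field_derivative
        deriv ((zderiv ^^ n) f) (l x) * (1 / exp (l x))) (at x)" .
    then have "((deriv ^^ n) (\<lambda>x. f (l x)) has_field_derivative
        deriv ((zderiv ^^ n) f) (l x) * (1 / exp (l x))) (at x)"
      by (rule has_field_derivative_transform_within_open[OF _ oT Suc.prems]) (simp add: Suc.IH)
    then show ?case
      using zderiv_holomorphic_eq[OF hz S x(2)] by (simp add: DERIV_imp_deriv)
  qed simp
  have "(f \<circ> l) holomorphic_on T"
    by (rule holomorphic_on_compose_gen[where t = S])
       (use f hl in \<open>auto simp: T_def intro: holomorphic_on_subset\<close>)
  then have "(\<lambda>x. f (l x)) has_fps_expansion fps_expansion (\<lambda>x. f (l x)) 0"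
    using oT T0 by (intro has_fps_expansion_fps_expansion) (auto simp: o_def)
  moreover have "fps_expansion (\<lambda>x. f (l x)) 0 = jet f w"
    using der[OF T0] by (simp add: fps_expansion_def jet_def l_def)
  ultimately show ?thesis by (simp add: l_def)
qed

lemma jet_eqI:
  assumes "f holomorphic_on S" "open S" "w \<in> S"
    and "(\<lambda>x. f (w + Ln (1 + x / exp w))) has_fps_expansion F"
  shows "jet f w = F"
  using fps_expansion_unique_complex[OF has_fps_expansion_jet[OF assms(1-3)] assms(4)] .

lemma jet_mult:
  assumes "f holomorphic_on S" "g holomorphic_on S" "open S" "w \<in> S"
  shows "jet (\<lambda>w. f w * g w) w = jet f w * jet g w"
  using assms
  by (intro jet_eqI[of _ S] holomorphic_intros has_fps_expansion_mult has_fps_expansion_jet)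

lemma jet_diff:
  assumes "f holomorphic_on S" "g holomorphic_on S" "open S" "w \<in> S"
  shows "jet (\<lambda>w. f w - g w) w = jet f w - jet g w"
  using assms
  by (intro jet_eqI[of _ S] holomorphic_intros has_fps_expansion_diff has_fps_expansion_jet)

text \<open>This is the Faa di Bruno formula. The value \<open>f w\<close> is subtracted because
  formal substitution requires a zero constant term.\<close>

lemma jet_compose:
  assumes f: "f holomorphic_on S" "open S" "w \<in> S"
    and g: "g holomorphic_on U" "open U" "f ` S \<subseteq> U"
  shows "jet (g \<circ> f) w = fps_expansion g (f w) oo (jet f w - fps_const (f w))"
proof (rule jet_eqI[OF _ f(2,3)])
  show "(g \<circ> f) holomorphic_on S"
    using f g by (intro holomorphic_on_compose_gen) auto
  have "g analytic_on {f w}"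
    using g f by (meson analytic_at image_subset_iff)
  then have 1: "(\<lambda>x. g (f w + x)) has_fps_expansion fps_expansion g (f w)"
    by (rule analytic_at_imp_has_fps_expansion)
  have 2: "(\<lambda>x. f (w + Ln (1 + x / exp w)) - f w) has_fps_expansion (jet f w - fps_const (f w))"
    by (intro has_fps_expansion_diff has_fps_expansion_jet[OF f] has_fps_expansion_const)
  have "((\<lambda>x. g (f w + x)) \<circ> (\<lambda>x. f (w + Ln (1 + x / exp w)) - f w)) has_fps_expansion
          (fps_expansion g (f w) oo (jet f w - fps_const (f w)))"
    by (rule has_fps_expansion_compose[OF 1 2]) (simp add: jet_nth)
  then show "(\<lambda>x. (g \<circ> f) (w + Ln (1 + x / exp w))) has_fps_expansion
          (fps_expansion g (f w) oo (jet f w - fps_const (f w)))"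
    by (simp add: o_def)
qed

section \<open>Composition of power series and of ultraholomorphic functions\<close>

lemma sum_powers_le_binomial:
  fixes x :: real
  assumes "x \<ge> 0"
  shows "(\<Sum>l\<le>n. x ^ l) \<le> (1 + x) ^ n"
proof -
  have "(\<Sum>l\<le>n. x ^ l) \<le> (\<Sum>l\<le>n. real (n choose l) * x ^ l * 1 ^ (n - l))"
  proof (rule sum_mono)
    fix l assume "l \<in> {..n}"
    then have "n choose l \<ge> 1" by (simp add: Suc_leI)
    then have "real (n choose l) \<ge> 1" by simp
    then have "1 * x ^ l \<le> real (n choose l) * x ^ l"
      using assms by (intro mult_right_mono) auto
    then show "x ^ l \<le> real (n choose l) * x ^ l * 1 ^ (n - l)" by simp
  qed
  also have "\<dots> = (1 + x) ^ n"
    using binomial_ring[of x 1 n] by (simp add: add.commute)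
  finally show ?thesis .
qed

text \<open>Splitting off the first part \<open>j\<close> of an ordered partition of
  \<open>n\<close> leaves the bound \<open>Q / m j\<close> for the product over the other parts,
  which drives the induction on \<open>i\<close>. The factor 2 ^ n pays for the number of
  partitions.\<close>

lemma fps_power_nth_bound:
  fixes G :: "complex fps" and m :: "nat \<Rightarrow> real"
  assumes G0: "G $ 0 = 0" and G: "\<And>j. j \<ge> 1 \<Longrightarrow> norm (G $ j) \<le> A * h ^ j * m j"
    and A: "A \<ge> 0" and h: "h \<ge> 0" and m: "\<And>j. m j > 0"
    and "\<And>js. length js = i \<Longrightarrow> (\<forall>j\<in>set js. j \<ge> 1) \<Longrightarrow> sum_list js = n
           \<Longrightarrow> prod_list (map m js) \<le> Q"
    and "Q \<ge> 0"
  shows "norm ((G ^ i) $ n) \<le> A ^ i * (2 * h) ^ n * Q"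
  using assms(6,7)
proof (induction i arbitrary: n Q)
  case 0
  show ?case using "0"(1)[of "[]"] "0"(2) h by (cases "n = 0") auto
next
  case (Suc i)
  have summand: "norm (G $ j * (G ^ i) $ (n - j)) \<le> A ^ Suc i * Q * h ^ n * 2 ^ (n - j)"
    if j: "j \<in> {1..n}" for j
  proof -
    have "norm ((G ^ i) $ (n - j)) \<le> A ^ i * (2 * h) ^ (n - j) * (Q / m j)"
    proof (rule Suc.IH)
      fix js assume js: "length js = i" "\<forall>j\<in>set js. j \<ge> 1" "sum_list js = n - j"
      have "prod_list (map m (j # js)) \<le> Q"
        by (rule Suc.prems(1)) (use js j in auto)
      then show "prod_list (map m js) \<le> Q / m j"
        using m[of j] by (simp add: field_simps)
    qed (use Suc.prems(2) m[of j] in auto)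
    then have "norm (G $ j) * norm ((G ^ i) $ (n - j))
                 \<le> (A * h ^ j * m j) * (A ^ i * (2 * h) ^ (n - j) * (Q / m j))"
      using G[of j] j A h m[of j] by (intro mult_mono) auto
    also have "\<dots> = A ^ Suc i * Q * (h ^ j * h ^ (n - j)) * 2 ^ (n - j)"
      using m[of j] by (simp add: field_simps power_mult_distrib)
    also have "h ^ j * h ^ (n - j) = h ^ n"
      using j by (simp flip: power_add)
    finally show ?thesis by (simp add: norm_mult)
  qed
  have "(G ^ Suc i) $ n = (\<Sum>j=0..n. G $ j * (G ^ i) $ (n - j))"
    by (simp add: fps_mult_nth)
  also have "\<dots> = (\<Sum>j=1..n. G $ j * (G ^ i) $ (n - j))"
    using G0 by (simp add: sum.atLeast_Suc_atMost)
  also have "norm \<dots> \<le> (\<Sum>j=1..n. A ^ Suc i * Q * h ^ n * 2 ^ (n - j))"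
    by (rule sum_norm_le) (use summand in auto)
  also have "\<dots> = A ^ Suc i * Q * h ^ n * (\<Sum>j=1..n. 2 ^ (n - j))"
    by (simp add: sum_distrib_left)
  also have "(\<Sum>j=1..n. 2 ^ (n - j)) = (\<Sum>j<n. (2::real) ^ j)"
    by (rule sum.reindex_bij_witness[of _ "\<lambda>j. n - j" "\<lambda>j. n - j"]) auto
  also have "A ^ Suc i * Q * h ^ n * (\<Sum>j<n. (2::real) ^ j) \<le> A ^ Suc i * Q * h ^ n * 2 ^ n"
    using A h Suc.prems(2) by (intro mult_left_mono) (auto simp: geometric_sum)
  finally show ?case
    by (simp add: power_mult_distrib mult_ac)
qed

text \<open>The outer weight \<open>b\<close> is kept separate since it will be constantly 1 under
  Cauchy estimates and \<open>check_seq (M p)\<close> under (FdB). Summing over the number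
  \<open>l\<close> of factors costs (1 + k A) ^ n; the term l = 0 vanishes as n >= 1.\<close>

lemma fps_compose_nth_bound:
  fixes F G :: "complex fps" and m b :: "nat \<Rightarrow> real"
  assumes G0: "G $ 0 = 0" and G: "\<And>j. j \<ge> 1 \<Longrightarrow> norm (G $ j) \<le> A * h ^ j * m j"
    and F: "\<And>l. norm (F $ l) \<le> C * k ^ l * b l"
    and pos: "A \<ge> 0" "h \<ge> 0" "C \<ge> 0" "k \<ge> 0" "\<And>j. m j > 0" "\<And>l. b l > 0" "Q \<ge> 0"
    and n: "n \<ge> 1"
    and Q: "\<And>js. js \<noteq> [] \<Longrightarrow> (\<forall>j\<in>set js. j \<ge> 1) \<Longrightarrow> sum_list js = n
           \<Longrightarrow> b (length js) * prod_list (map m js) \<le> Q"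
  shows "norm ((F oo G) $ n) \<le> C * ((1 + k * A) * (2 * h)) ^ n * Q"
proof -
  have summand: "norm (F $ l * (G ^ l) $ n) \<le> (C * (2 * h) ^ n * Q) * (k * A) ^ l" if "l \<le> n" for l
  proof (cases "l = 0")
    case True
    then show ?thesis using n pos by simp
  next
    case False
    have "norm ((G ^ l) $ n) \<le> A ^ l * (2 * h) ^ n * (Q / b l)"
    proof (rule fps_power_nth_bound[OF G0 G])
      fix js assume js: "length js = l" "\<forall>j\<in>set js. j \<ge> 1" "sum_list js = n"
      have "b (length js) * prod_list (map m js) \<le> Q"
        by (rule Q) (use js False in auto)
      then show "prod_list (map m js) \<le> Q / b l"
        using pos(6)[of l] js by (simp add: field_simps)
    qed (use pos pos(6)[of l] in \<open>auto simp: less_imp_le\<close>)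
    then have "norm (F $ l) * norm ((G ^ l) $ n)
                 \<le> (C * k ^ l * b l) * (A ^ l * (2 * h) ^ n * (Q / b l))"
      using F[of l] pos pos(6)[of l] by (intro mult_mono) (auto simp: less_imp_le)
    also have "\<dots> = (C * (2 * h) ^ n * Q) * (k * A) ^ l"
      using pos(6)[of l] by (simp add: field_simps power_mult_distrib)
    finally show ?thesis by (simp add: norm_mult)
  qed
  have "norm ((F oo G) $ n) \<le> (\<Sum>l\<le>n. norm (F $ l * (G ^ l) $ n))"
    unfolding fps_compose_nth atMost_atLeast0 by (rule norm_sum)
  also have "\<dots> \<le> (\<Sum>l\<le>n. (C * (2 * h) ^ n * Q) * (k * A) ^ l)"
    by (rule sum_mono) (use summand in auto)
  also have "\<dots> = (C * (2 * h) ^ n * Q) * (\<Sum>l\<le>n. (k * A) ^ l)"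
    by (simp add: sum_distrib_left)
  also have "\<dots> \<le> (C * (2 * h) ^ n * Q) * (1 + k * A) ^ n"
    using pos by (intro mult_left_mono sum_powers_le_binomial) auto
  finally show ?thesis by (simp only: power_mult_distrib mult_ac)
qed

lemma prod_list_le_power_sum_list:
  fixes m :: "nat \<Rightarrow> real"
  assumes "\<And>j. j \<in> set js \<Longrightarrow> 0 \<le> m j \<and> m j \<le> c ^ j" "c \<ge> 0"
  shows "prod_list (map m js) \<le> c ^ sum_list js"
  using assms(1)
proof (induction js)
  case (Cons j js)
  have "m j * prod_list (map m js) \<le> c ^ j * c ^ sum_list js"
    using Cons assms(2) by (intro mult_mono prod_list_nonneg) auto
  then show ?case by (simp add: power_add)
qed simp

section \<open>Membership in the classes in terms of Taylor coefficients\<close>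

lemma check_seq_pos: "m j > 0 \<Longrightarrow> check_seq m j > 0"
  by (simp add: check_seq_def)

lemma weight_matrix_pos: "weight_matrix M \<Longrightarrow> p > 0 \<Longrightarrow> M p j > 0"
  by (simp add: weight_matrix_def)

lemma weight_matrix_0: "weight_matrix M \<Longrightarrow> p > 0 \<Longrightarrow> M p 0 = 1"
  by (simp add: weight_matrix_def)

lemma weight_matrix_mono: "weight_matrix M \<Longrightarrow> p > 0 \<Longrightarrow> p \<le> q \<Longrightarrow> M p j \<le> M q j"
  by (simp add: weight_matrix_def)

lemma check_seq_weight_pos: "weight_matrix M \<Longrightarrow> p > 0 \<Longrightarrow> check_seq (M p) j > 0"
  by (simp add: check_seq_pos weight_matrix_pos)

lemma check_seq_weight_mono:
  "weight_matrix M \<Longrightarrow> p > 0 \<Longrightarrow> p \<le> q \<Longrightarrow> check_seq (M p) j \<le> check_seq (M q) j"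
  by (simp add: check_seq_def weight_matrix_mono divide_right_mono)

lemma bdd_above_weighted_iff:
  fixes b :: "nat \<Rightarrow> real"
  assumes "h > 0" "\<And>j. b j > 0"
  shows "bdd_above ((\<lambda>(w, j). norm (F j w) / (h ^ j * b j)) ` (S \<times> UNIV)) \<longleftrightarrow>
         (\<exists>A>0. \<forall>w\<in>S. \<forall>j. norm (F j w) \<le> A * h ^ j * b j)"
proof
  assume "bdd_above ((\<lambda>(w, j). norm (F j w) / (h ^ j * b j)) ` (S \<times> UNIV))"
  then obtain A where A: "\<And>w j. w \<in> S \<Longrightarrow> norm (F j w) / (h ^ j * b j) \<le> A"
    by (auto simp: bdd_above_def)
  have "norm (F j w) \<le> max 1 A * h ^ j * b j" if "w \<in> S" for w j
  proof -
    have "norm (F j w) / (h ^ j * b j) \<le> max 1 A" using A[OF that, of j] by simp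
    then show ?thesis using assms by (simp add: pos_divide_le_eq mult_ac)
  qed
  then show "\<exists>A>0. \<forall>w\<in>S. \<forall>j. norm (F j w) \<le> A * h ^ j * b j"
    by (intro exI[of _ "max 1 A"]) auto
next
  assume "\<exists>A>0. \<forall>w\<in>S. \<forall>j. norm (F j w) \<le> A * h ^ j * b j"
  then obtain A where A: "\<And>w j. w \<in> S \<Longrightarrow> norm (F j w) \<le> A * h ^ j * b j" by blast
  show "bdd_above ((\<lambda>(w, j). norm (F j w) / (h ^ j * b j)) ` (S \<times> UNIV))"
    unfolding bdd_above_def
    by (rule exI[of _ A]) (use A assms in \<open>auto simp: pos_divide_le_eq mult_ac\<close>)
qed

lemma ultraholo_iff_jet:
  assumes "weight_matrix M"
  shows "f \<in> ultraholo M S \<longleftrightarrow> f holomorphic_on S \<and> (\<exists>p>0. \<exists>h>0. \<exists>A>0. \<forall>w\<in>S. \<forall>j.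
           norm (jet f w $ j) \<le> A * h ^ j * check_seq (M p) j)"
proof -
  have "f \<in> ultraholo M S \<longleftrightarrow> f holomorphic_on S \<and> (\<exists>p>0. \<exists>h>0. \<exists>A>0. \<forall>w\<in>S. \<forall>j.
           norm ((zderiv ^^ j) f w) \<le> A * h ^ j * M p j)"
  proof -
    have "f \<in> ultraholo_seq (M p) S \<longleftrightarrow> f holomorphic_on S \<and> (\<exists>h>0. \<exists>A>0. \<forall>w\<in>S. \<forall>j.
           norm ((zderiv ^^ j) f w) \<le> A * h ^ j * M p j)" if "p > 0" for p
      using bdd_above_weighted_iff[where b = "M p" and F = "\<lambda>j. (zderiv ^^ j) f" and S = S]
        weight_matrix_pos[OF assms that]
      unfolding ultraholo_seq_def mem_Collect_eq by meson
    then show ?thesis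
      unfolding ultraholo_def UN_iff greaterThan_iff by blast
  qed
  then show ?thesis
    by (simp add: jet_nth check_seq_def norm_divide divide_le_cancel)
qed

lemma ultraholoE:
  assumes "weight_matrix M" "f \<in> ultraholo M S"
  obtains p h A where "p > 0" "h > 0" "A > 0" "f holomorphic_on S"
    "\<And>w j. w \<in> S \<Longrightarrow> norm (jet f w $ j) \<le> A * h ^ j * check_seq (M p) j"
  using assms(2) unfolding ultraholo_iff_jet[OF assms(1)] by blast

lemma ultraholoI:
  assumes "weight_matrix M" "f holomorphic_on S" "p > 0" "h > 0"
    and "\<And>w j. w \<in> S \<Longrightarrow> norm (jet f w $ j) \<le> A * h ^ j * check_seq (M p) j"
  shows "f \<in> ultraholo M S"
proof -
  have "norm (jet f w $ j) \<le> max 1 A * h ^ j * check_seq (M p) j" if "w \<in> S" for w j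
  proof -
    have "A * h ^ j * check_seq (M p) j \<le> max 1 A * h ^ j * check_seq (M p) j"
      using assms(4) check_seq_weight_pos[OF assms(1,3), of j] by (intro mult_right_mono) auto
    then show ?thesis using assms(5)[OF that, of j] by linarith
  qed
  then show ?thesis
    unfolding ultraholo_iff_jet[OF assms(1)] using assms(2,3,4)
    by (intro conjI exI[of _ p] exI[of _ h] exI[of _ "max 1 A"]) auto
qed

lemma ultraholo_bounded:
  assumes "weight_matrix M" "f \<in> ultraholo M S"
  shows "\<exists>A>0. \<forall>w\<in>S. norm (f w) \<le> A"
proof -
  obtain p h A where p: "p > 0" and A: "A > 0"
    and b: "\<And>w j. w \<in> S \<Longrightarrow> norm (jet f w $ j) \<le> A * h ^ j * check_seq (M p) j"
    using ultraholoE[OF assms] by metis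
  show ?thesis
    using b[of _ 0] A weight_matrix_0[OF assms(1) p] by (auto simp: jet_nth check_seq_def)
qed

lemma compact_closure_range_ultraholo:
  assumes "weight_matrix M" "f \<in> ultraholo M S"
  shows "compact (closure (f ` S))"
  using ultraholo_bounded[OF assms] by (auto simp: compact_closure bounded_iff)

text \<open>Common core of the closedness results from (rai) and from (FdB): the matrix condition
  enters only through \<open>est\<close>, the regularity of \<open>g\<close> only through
  \<open>b\<close>.\<close>

lemma compose_in_ultraholo:
  assumes M: "weight_matrix M" and S: "open S" and f: "f holomorphic_on S" and p: "p > 0"
    and h: "h > 0" and A: "A > 0"
    and bf: "\<And>w j. w \<in> S \<Longrightarrow> norm (jet f w $ j) \<le> A * h ^ j * check_seq (M p) j"
    and g: "g holomorphic_on U" and U: "open U" "f ` S \<subseteq> U"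
    and C: "C > 0" and k: "k > 0" and b: "\<And>l. b l > 0"
    and bg: "\<And>z l. z \<in> f ` S \<Longrightarrow> norm ((deriv ^^ l) g z / fact l) \<le> C * k ^ l * b l"
    and q: "q > 0" and B: "B > 0" and D: "D > 0"
    and est: "\<And>js. js \<noteq> [] \<Longrightarrow> (\<forall>j\<in>set js. j \<ge> 1) \<Longrightarrow>
       b (length js) * prod_list (map (check_seq (M p)) js)
         \<le> D * B ^ sum_list js * check_seq (M q) (sum_list js)"
  shows "g \<circ> f \<in> ultraholo M S"
proof (rule ultraholoI[OF M _ q])
  show "(g \<circ> f) holomorphic_on S"
    using f g U by (intro holomorphic_on_compose_gen) auto
  let ?h = "(1 + k * A) * (2 * h) * B"
  show "?h > 0" using h B k A by (simp add: add_pos_pos)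
  fix w n assume w: "w \<in> S"
  have J: "jet (g \<circ> f) w = fps_expansion g (f w) oo (jet f w - fps_const (f w))"
    by (rule jet_compose[OF f S w g U])
  \<comment> \<open>\<open>est\<close> concerns nonempty lists and says nothing about order 0, where
    the bound on \<open>g\<close> itself gives the constant \<open>C * b 0\<close>.\<close>
  show "norm (jet (g \<circ> f) w $ n) \<le> (C * max D (b 0)) * ?h ^ n * check_seq (M q) n"
  proof (cases "n = 0")
    case True
    then show ?thesis
      using bg[of "f w" 0] w weight_matrix_0[OF M q] C
      by (simp add: jet_nth check_seq_def)
         (meson dual_order.trans max.cobounded2 mult_left_mono less_imp_le)
  next
    case False
    have "norm ((fps_expansion g (f w) oo (jet f w - fps_const (f w))) $ n)
        \<le> C * ((1 + k * A) * (2 * h)) ^ n * (D * B ^ n * check_seq (M q) n)"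
    proof (rule fps_compose_nth_bound[where m = "check_seq (M p)" and b = b])
      show "norm ((jet f w - fps_const (f w)) $ j) \<le> A * h ^ j * check_seq (M p) j"
        if "1 \<le> j" for j using bf[OF w, of j] that by simp
      show "norm (fps_expansion g (f w) $ l) \<le> C * k ^ l * b l" for l
        using bg[of "f w" l] w by (simp add: fps_expansion_def)
    qed (use A h C k b D B False est check_seq_weight_pos[OF M p]
           check_seq_weight_pos[OF M q] in \<open>auto simp: jet_nth less_imp_le\<close>)
    also have "\<dots> = C * D * ?h ^ n * check_seq (M q) n"
      by (simp only: power_mult_distrib mult_ac)
    also have "\<dots> \<le> (C * max D (b 0)) * ?h ^ n * check_seq (M q) n"
      using C \<open>?h > 0\<close> check_seq_weight_pos[OF M q, of n]
      by (intro mult_right_mono mult_left_mono) auto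
    finally show ?thesis by (simp add: J)
  qed
qed

lemma Cauchy_estimate_compact:
  assumes "g holomorphic_on U" "open U" "compact K" "K \<subseteq> U"
  obtains C k where "C > 0" "k > 0"
    "\<And>z l. z \<in> K \<Longrightarrow> norm ((deriv ^^ l) g z / fact l) \<le> C * k ^ l"
proof -
  obtain e where e: "e > 0" "(\<Union>x\<in>K. cball x e) \<subseteq> U"
    using compact_subset_open_imp_cball_epsilon_subset[OF assms(3,2,4)] by blast
  define T where "T = (\<Union>x\<in>K. cball x e)"
  have "compact T"
    unfolding T_def using compact_minkowski_sum_cball[OF assms(3)] by simp
  then have "bounded (g ` T)"
    using e assms(1) unfolding T_def
    by (meson compact_continuous_image compact_imp_bounded holomorphic_on_imp_continuous_on
        holomorphic_on_subset)
  then obtain C where C: "C > 0" "\<And>x. x \<in> T \<Longrightarrow> norm (g x) \<le> C"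
    by (auto simp: bounded_pos)
  have "norm ((deriv ^^ l) g z / fact l) \<le> C * (1 / e) ^ l" if z: "z \<in> K" for z l
  proof -
    have sub: "cball z e \<subseteq> U" using z e by auto
    have "norm ((deriv ^^ l) g z) \<le> fact l * C / e ^ l"
    proof (rule Cauchy_inequality)
      show "g holomorphic_on ball z e"
        using sub assms(1) ball_subset_cball holomorphic_on_subset by blast
      show "continuous_on (cball z e) g"
        using sub assms(1) holomorphic_on_imp_continuous_on holomorphic_on_subset by blast
      show "norm (g x) \<le> C" if "norm (z - x) = e" for x
        using that z by (intro C(2)) (auto simp: T_def dist_norm)
    qed (use e in auto)
    then show ?thesis
      by (simp add: norm_divide power_divide field_simps)
  qed
  then show thesis using that[of C "1/e"] C e by simp
qed

section \<open>Stability implications\<close>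

text \<open>If the entries of \<open>js\<close> sum to \<open>n\<close>, (rai) bounds the factor of
  index j by c ^ j with one common c = B * root n (check_seq (M q) n). The product therefore
  collapses to c ^ n = B ^ n * check_seq (M q) n. Cauchy estimates allow the outer weight 1.\<close>

lemma rai_imp_holomorphically_closed:
  assumes M: "weight_matrix M" and S: "open S" and rai: "matrix_rai M"
  shows "holomorphically_closed M S"
  unfolding holomorphically_closed_def
proof (intro ballI allI impI, elim conjE)
  fix f U g assume f: "f \<in> ultraholo M S" and U: "open U" "closure (f ` S) \<subseteq> U"
    and g: "g holomorphic_on U"
  obtain p h A where p: "p > 0" and h: "h > 0" and A: "A > 0" and hf: "f holomorphic_on S"
    and b: "\<And>w j. w \<in> S \<Longrightarrow> norm (jet f w $ j) \<le> A * h ^ j * check_seq (M p) j"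
    using ultraholoE[OF M f] by metis
  obtain C k where C: "C > 0" and k: "k > 0"
    and bg: "\<And>z l. z \<in> closure (f ` S) \<Longrightarrow> norm ((deriv ^^ l) g z / fact l) \<le> C * k ^ l"
    using Cauchy_estimate_compact[OF g U(1) compact_closure_range_ultraholo[OF M f] U(2)] by blast
  obtain B q where B: "B > 0" and q: "q > 0" and r: "\<And>j k. 1 \<le> j \<Longrightarrow> j \<le> k \<Longrightarrow>
      root j (check_seq (M p) j) \<le> B * root k (check_seq (M q) k)"
    using rai p unfolding matrix_rai_def by metis
  show "g \<circ> f \<in> ultraholo M S"
  proof (rule compose_in_ultraholo[OF M S hf p h A b g U(1) _ C k _ _ q B])
    show "f ` S \<subseteq> U" using U(2) closure_subset by blast
    show "norm ((deriv ^^ l) g z / fact l) \<le> C * k ^ l * 1" if "z \<in> f ` S" for z l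
      using bg[OF subsetD[OF closure_subset that], of l] by simp
    fix js :: "nat list" assume js: "js \<noteq> []" "\<forall>j\<in>set js. j \<ge> 1"
    define n where "n = sum_list js"
    have jn: "j \<le> n" if "j \<in> set js" for j
      unfolding n_def using that by (intro member_le_sum_list) auto
    have n: "n \<ge> 1"
      using js(2)[rule_format, OF hd_in_set[OF js(1)]] jn[OF hd_in_set[OF js(1)]] by linarith
    have pos: "check_seq (M q) n > 0" by (rule check_seq_weight_pos[OF M q])
    have "prod_list (map (check_seq (M p)) js) \<le> (B * root n (check_seq (M q) n)) ^ sum_list js"
    proof (rule prod_list_le_power_sum_list)
      show "0 \<le> check_seq (M p) j \<and> check_seq (M p) j \<le> (B * root n (check_seq (M q) n)) ^ j"
        if "j \<in> set js" for j
      proof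
        have j: "j \<ge> 1" using js that by blast
        have pos: "check_seq (M p) j > 0" by (rule check_seq_weight_pos[OF M p])
        then show "0 \<le> check_seq (M p) j" by simp
        have "check_seq (M p) j = root j (check_seq (M p) j) ^ j"
          using j pos by simp
        also have "\<dots> \<le> (B * root n (check_seq (M q) n)) ^ j"
          using r[OF j jn[OF that]] pos by (intro power_mono) (auto intro: real_root_ge_zero)
        finally show "check_seq (M p) j \<le> (B * root n (check_seq (M q) n)) ^ j" .
      qed
    qed (use B pos in \<open>auto intro!: mult_nonneg_nonneg real_root_ge_zero\<close>)
    also have "\<dots> = B ^ n * check_seq (M q) n"
      using n pos by (simp add: power_mult_distrib flip: n_def)
    finally show "1 * prod_list (map (check_seq (M p)) js)
                    \<le> 1 * B ^ sum_list js * check_seq (M q) (sum_list js)"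
      by (simp add: n_def)
  qed auto
qed

lemma holomorphically_closed_imp_inverse_closed:
  assumes "holomorphically_closed M S"
  shows "inverse_closed M S"
  unfolding inverse_closed_def
proof (intro ballI impI)
  fix f assume f: "f \<in> ultraholo M S" and pos: "(INF w\<in>S. norm (f w)) > 0"
  define c where "c = (INF w\<in>S. norm (f w))"
  have "c \<le> norm (f w)" if "w \<in> S" for w
    unfolding c_def using that by (intro cINF_lower) (auto intro: bdd_belowI[of _ 0])
  then have "closure (f ` S) \<subseteq> {z. c \<le> norm z}"
    by (intro closure_minimal closed_Collect_le continuous_intros) auto
  also have "\<dots> \<subseteq> - {0}" using pos by (auto simp: c_def)
  finally have sub: "closure (f ` S) \<subseteq> - {0}" .
  have "(\<lambda>z. 1 / z) holomorphic_on - {0 :: complex}"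
    by (intro holomorphic_intros) auto
  with sub have "(\<lambda>z. 1 / z) \<circ> f \<in> ultraholo M S"
    using assms f unfolding holomorphically_closed_def by (blast intro: open_Compl)
  then show "(\<lambda>w. 1 / f w) \<in> ultraholo M S" by (simp add: o_def)
qed

section \<open>Closedness under composition and the conditions (FdB), (C^omega), (dc)\<close>

lemma le_circ_seq:
  assumes "js \<noteq> []" "\<forall>j\<in>set js. j \<ge> 1"
  shows "m (length js) * prod_list (map m js) \<le> circ_seq m (sum_list js)"
proof -
  have "m (length js) * prod_list (map m js) \<in> circ_products m (sum_list js)"
    unfolding circ_products_def using assms by blast
  moreover have "sum_list js \<noteq> 0" using assms by (cases js) auto
  ultimately show ?thesis
    unfolding circ_seq_def by (auto intro: Max_ge[OF finite_circ_products])
qed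

lemma FdB_imp_composition_closed:
  assumes M: "weight_matrix M" and S: "open S" and FdB: "matrix_FdB M"
  shows "composition_closed M S"
  unfolding composition_closed_def
proof (intro ballI allI impI, elim conjE)
  fix f U g assume f: "f \<in> ultraholo M S" and U: "open U" "closure (f ` S) \<subseteq> U"
    and g: "g \<in> local_class M U"
  obtain p1 h A where p1: "p1 > 0" and h: "h > 0" and A: "A > 0" and hf: "f holomorphic_on S"
    and b1: "\<And>w j. w \<in> S \<Longrightarrow> norm (jet f w $ j) \<le> A * h ^ j * check_seq (M p1) j"
    using ultraholoE[OF M f] by metis
  have hg: "g holomorphic_on U" using g by (simp add: local_class_def)
  \<comment> \<open>The order 0 bound makes the range of \<open>f\<close> bounded, so its closure is
    a compact set on which the local bounds for \<open>g\<close> are uniform.\<close>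
  obtain p2 k where p2: "p2 > 0" and k: "k > 0" and
    "bdd_above ((\<lambda>(z, j). norm ((deriv ^^ j) g z) / (k ^ j * M p2 j)) ` (closure (f ` S) \<times> UNIV))"
    using g compact_closure_range_ultraholo[OF M f] U(2) unfolding local_class_def by blast
  then obtain C where C: "C > 0"
    and bg: "\<And>z l. z \<in> closure (f ` S) \<Longrightarrow> norm ((deriv ^^ l) g z) \<le> C * k ^ l * M p2 l"
    unfolding bdd_above_weighted_iff[OF k, of "M p2" "\<lambda>l. (deriv ^^ l) g", OF weight_matrix_pos[OF M p2]]
    by blast
  \<comment> \<open>(FdB) uses one sequence for inner and outer factors, hence a common index for
    \<open>f\<close> and \<open>g\<close>.\<close>
  define p where "p = max p1 p2"
  have p: "p > 0" using p1 by (simp add: p_def)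
  obtain q where q: "q > 0" and "seq_preceq (circ_seq (check_seq (M p))) (check_seq (M q))"
    using FdB p unfolding matrix_FdB_def by blast
  then obtain D B where D: "D > 0" and B: "B > 0"
    and circ: "\<And>j. circ_seq (check_seq (M p)) j \<le> D * B ^ j * check_seq (M q) j"
    unfolding seq_preceq_def by blast
  show "g \<circ> f \<in> ultraholo M S"
  proof (rule compose_in_ultraholo[OF M S hf p h A _ hg U(1) _ C k check_seq_weight_pos[OF M p]
          _ q B D])
    show "f ` S \<subseteq> U" using U(2) closure_subset by blast
    show "norm (jet f w $ j) \<le> A * h ^ j * check_seq (M p) j" if "w \<in> S" for w j
    proof -
      have "A * h ^ j * check_seq (M p1) j \<le> A * h ^ j * check_seq (M p) j"
        using A h p1 by (intro mult_left_mono check_seq_weight_mono[OF M]) (auto simp: p_def)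
      then show ?thesis using b1[OF that, of j] by linarith
    qed
    show "norm ((deriv ^^ l) g z / fact l) \<le> C * k ^ l * check_seq (M p) l" if "z \<in> f ` S" for z l
    proof -
      have "norm ((deriv ^^ l) g z) \<le> C * k ^ l * M p2 l"
        by (rule bg[OF subsetD[OF closure_subset that]])
      also have "\<dots> \<le> C * k ^ l * M p l"
        using C k p2 by (intro mult_left_mono weight_matrix_mono[OF M]) (auto simp: p_def)
      finally show ?thesis
        by (simp add: norm_divide check_seq_def divide_right_mono)
    qed
    show "check_seq (M p) (length js) * prod_list (map (check_seq (M p)) js)
        \<le> D * B ^ sum_list js * check_seq (M q) (sum_list js)"
      if "js \<noteq> []" "\<forall>j\<in>set js. j \<ge> 1" for js
      using le_circ_seq[OF that, of "check_seq (M p)"] circ by (rule order_trans)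
  qed
qed

text \<open>The liminf yields a geometric lower bound for large \<open>j\<close>; the finitely many
  other indices are absorbed into \<open>A\<close>.\<close>

lemma Comega_lower_bound:
  assumes M: "weight_matrix M" and "matrix_Comega M"
  obtains p A B where "p > 0" "A > 0" "B > 0" "\<And>j. 1 \<le> A * B ^ j * check_seq (M p) j"
proof -
  obtain p where p: "p > 0" and "liminf (\<lambda>j. ereal (root j (check_seq (M p) j))) > 0"
    using assms(2) unfolding matrix_Comega_def by blast
  then obtain c where c: "0 < ereal c"
    "ereal c < liminf (\<lambda>j. ereal (root j (check_seq (M p) j)))"
    using ereal_dense3 by (metis ereal_dense2 ereal_less(2) less_ereal.simps(1))
  then obtain N where N: "\<And>j. j \<ge> N \<Longrightarrow> c < root j (check_seq (M p) j)"
    using less_LiminfD[OF c(2)] by (auto simp: eventually_sequentially)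
  have c0: "c > 0" using c(1) by simp
  define B where "B = 1 / c"
  have B: "B > 0" using c0 by (simp add: B_def)
  let ?X = "insert 1 ((\<lambda>j. 1 / (B ^ j * check_seq (M p) j)) ` {..Suc N})"
  define A where "A = Max ?X"
  have A1: "A \<ge> 1" unfolding A_def by (intro Max_ge) auto
  have pos: "check_seq (M p) j > 0" for j by (rule check_seq_weight_pos[OF M p])
  have "1 \<le> A * B ^ j * check_seq (M p) j" for j
  proof (cases "j \<le> Suc N")
    case True
    then have "1 / (B ^ j * check_seq (M p) j) \<le> A"
      unfolding A_def by (intro Max_ge) auto
    then show ?thesis using B pos[of j] by (simp add: pos_divide_le_eq mult_ac)
  next
    case False
    then have "c ^ j \<le> root j (check_seq (M p) j) ^ j"
      using N[of j] c0 by (intro power_mono) auto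
    also have "\<dots> = check_seq (M p) j" using False pos[of j] by simp
    finally have "1 \<le> B ^ j * check_seq (M p) j"
      using c0 by (simp add: B_def power_divide)
    also have "\<dots> \<le> A * (B ^ j * check_seq (M p) j)"
      using mult_right_mono[OF A1, of "B ^ j * check_seq (M p) j"] B pos[of j] by simp
    finally show ?thesis by (simp add: mult_ac)
  qed
  then show thesis using that[of p A B] p A1 B by auto
qed

text \<open>Cauchy estimates give derivatives of size C k^l l!, and the geometric lower bound for
  \<open>check_seq (M p)\<close> turns l! into \<open>M p l\<close>.\<close>

lemma Comega_holomorphic_imp_local_class:
  assumes M: "weight_matrix M" and "matrix_Comega M" and U: "open U" and g: "g holomorphic_on U"
  shows "g \<in> local_class M U"
proof -
  obtain p A B where p: "p > 0" and A: "A > 0" and B: "B > 0"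
    and low: "\<And>j. 1 \<le> A * B ^ j * check_seq (M p) j"
    using Comega_lower_bound[OF assms(1,2)] by blast
  have "\<exists>p>0. \<exists>h>0. bdd_above ((\<lambda>(z, j). norm ((deriv ^^ j) g z) / (h ^ j * M p j)) ` (K \<times> UNIV))"
    if K: "compact K" "K \<subseteq> U" for K
  proof -
    obtain C k where C: "C > 0" and k: "k > 0"
      and bg: "\<And>z l. z \<in> K \<Longrightarrow> norm ((deriv ^^ l) g z / fact l) \<le> C * k ^ l"
      using Cauchy_estimate_compact[OF g U K] by blast
    have "norm ((deriv ^^ l) g z) \<le> (C * A) * (k * B) ^ l * M p l" if z: "z \<in> K" for z l
    proof -
      have "norm ((deriv ^^ l) g z / fact l) \<le> C * k ^ l * 1"
        using bg[OF z, of l] by simp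
      also have "\<dots> \<le> C * k ^ l * (A * B ^ l * check_seq (M p) l)"
        using low C k by (intro mult_left_mono) auto
      finally show ?thesis
        by (simp add: check_seq_def norm_divide field_simps power_mult_distrib)
    qed
    then have "\<exists>A>0. \<forall>z\<in>K. \<forall>l. norm ((deriv ^^ l) g z) \<le> A * (k * B) ^ l * M p l"
      using C A by (intro exI[of _ "C * A"]) auto
    then show ?thesis
      using bdd_above_weighted_iff[of "k * B" "M p" "\<lambda>l. (deriv ^^ l) g"] weight_matrix_pos[OF M p]
        p k B by (intro exI[of _ p] conjI exI[of _ "k * B"]) auto
  qed
  then show ?thesis using g by (auto simp: local_class_def)
qed

lemma composition_closed_imp_holomorphically_closed:
  assumes "weight_matrix M" "matrix_Comega M" "composition_closed M S"
  shows "holomorphically_closed M S"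
  using assms Comega_holomorphic_imp_local_class[OF assms(1,2)]
  unfolding holomorphically_closed_def composition_closed_def by blast

text \<open>With (dc), each factor \<open>check_seq (M p) j\<close> is traded for \<open>check_seq (M p') (j - 1)\<close>; this frees
  the \<open>l\<close> units needed to absorb the outer factor \<open>check_seq (M p) l\<close>.\<close>

lemma rai_dc_imp_FdB:
  assumes M: "weight_matrix M" and rai: "matrix_rai M" and dc: "matrix_dc M"
  shows "matrix_FdB M"
  unfolding matrix_FdB_def
proof (intro allI impI)
  fix p :: real assume p: "p > 0"
  obtain C0 p1 where p1: "p1 > 0" and C0: "\<And>j. M p (j + 1) \<le> C0 ^ (j + 1) * M p1 j" "C0 > 0"
    using dc p unfolding matrix_dc_def by metis
  \<comment> \<open>One index for both purposes: the outer factor keeps its order and needs p' >= p,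
    the inner ones are shifted by (dc) and need p' >= p1.\<close>
  define p' where "p' = max p p1"
  have p': "p' > 0" using p by (simp add: p'_def)
  obtain B q where B: "B > 0" and q: "q > 0" and r: "\<And>j k. 1 \<le> j \<Longrightarrow> j \<le> k \<Longrightarrow>
      root j (check_seq (M p') j) \<le> B * root k (check_seq (M q) k)"
    using rai p' unfolding matrix_rai_def by metis
  have pos: "check_seq (M p') j > 0" "check_seq (M p) j > 0" "check_seq (M q) j > 0" for j
    using check_seq_weight_pos[OF M] p p' q by auto
  have step: "check_seq (M p) j \<le> C0 ^ j * check_seq (M p') (j - 1)" if "j \<ge> 1" for j
  proof -
    define i where "i = j - 1"
    have i: "j = Suc i" using that by (simp add: i_def)
    have "M p j \<le> C0 ^ j * M p1 i" using C0(1)[of i] by (simp add: i)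
    also have "\<dots> \<le> C0 ^ j * M p' i"
      using C0(2) p1 by (intro mult_left_mono weight_matrix_mono[OF M]) (auto simp: p'_def)
    finally have "M p j \<le> C0 ^ j * M p' i" .
    then have "check_seq (M p) j \<le> C0 ^ j * M p' i / fact j"
      unfolding check_seq_def by (intro divide_right_mono) auto
    also have "\<dots> \<le> C0 ^ j * M p' i / fact i"
      using C0(2) weight_matrix_pos[OF M p', of i]
      by (intro divide_left_mono) (auto simp: i intro: fact_mono)
    finally show ?thesis by (simp add: i check_seq_def)
  qed
  have bound: "check_seq (M p) (length js) * prod_list (map (check_seq (M p)) js)
      \<le> (C0 * B) ^ n * check_seq (M q) n"
    if js: "js \<noteq> []" "\<forall>j\<in>set js. j \<ge> 1" "sum_list js = n" for js n
  proof -
    have jn: "j \<le> n" if "j \<in> set js" for j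
      using that unfolding js(3)[symmetric] by (intro member_le_sum_list) auto
    have n: "n \<ge> 1"
      using js(2)[rule_format, OF hd_in_set[OF js(1)]] jn[OF hd_in_set[OF js(1)]] by linarith
    define c where "c = B * root n (check_seq (M q) n)"
    have c: "c > 0" using B pos n by (simp add: c_def)
    \<comment> \<open>Index 0 matters here: an entry 1 of \<open>js\<close> is lowered to 0 by
      \<open>step\<close>.\<close>
    have pc: "check_seq (M p') j \<le> c ^ j" if "j \<le> n" for j
    proof (cases "j = 0")
      case True
      then show ?thesis using weight_matrix_0[OF M p'] by (simp add: check_seq_def)
    next
      case False
      have "check_seq (M p') j = root j (check_seq (M p') j) ^ j"
        using False pos(1)[of j] by simp
      also have "\<dots> \<le> c ^ j"
        unfolding c_def using r[of j n] that False pos(1)[of j]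
        by (intro power_mono) (auto intro: real_root_ge_zero)
      finally show ?thesis .
    qed
    have len: "length js \<le> n" using js(2) unfolding js(3)[symmetric]
      by (induction js) auto
    have "prod_list (map (check_seq (M p)) js) * c ^ length js \<le> (C0 * c) ^ sum_list js"
      using js(2) jn
    proof (induction js)
      case (Cons j js)
      have "check_seq (M p) j * c \<le> (C0 * c) ^ j"
      proof -
        have "check_seq (M p) j * c \<le> C0 ^ j * check_seq (M p') (j - 1) * c"
          using step[of j] Cons.prems c by (intro mult_right_mono) auto
        also have "\<dots> \<le> C0 ^ j * c ^ (j - 1) * c"
          using pc[of "j - 1"] Cons.prems(2)[of j] c C0(2) by (intro mult_right_mono mult_left_mono) auto
        also have "\<dots> = (C0 * c) ^ j"
          using Cons.prems by (cases j) (auto simp: power_mult_distrib)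
        finally show ?thesis .
      qed
      moreover have "prod_list (map (check_seq (M p)) js) * c ^ length js \<le> (C0 * c) ^ sum_list js"
        using Cons by auto
      ultimately have "(check_seq (M p) j * c) * (prod_list (map (check_seq (M p)) js) * c ^ length js)
          \<le> (C0 * c) ^ j * (C0 * c) ^ sum_list js"
        using c C0(2) pos by (intro mult_mono) (auto intro!: mult_nonneg_nonneg prod_list_nonneg simp: less_imp_le)
      then show ?case by (simp add: power_add mult_ac)
    qed simp
    then have prod: "prod_list (map (check_seq (M p)) js) * c ^ length js \<le> (C0 * c) ^ n"
      by (simp add: js(3))
    have "check_seq (M p) (length js) * prod_list (map (check_seq (M p)) js)
        \<le> c ^ length js * prod_list (map (check_seq (M p)) js)"
      using pc[OF len] check_seq_weight_mono[OF M p, of p' "length js"] pos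
      by (intro mult_right_mono prod_list_nonneg) (auto simp: p'_def less_imp_le)
    also have "\<dots> \<le> (C0 * c) ^ n" using prod by (simp add: mult_ac)
    also have "\<dots> = (C0 * B) ^ n * check_seq (M q) n"
      using n pos(3)[of n] by (simp add: c_def power_mult_distrib)
    finally show ?thesis .
  qed
  have "circ_seq (check_seq (M p)) n \<le> 1 * (C0 * B) ^ n * check_seq (M q) n" for n
  proof (cases "n = 0")
    case True
    then show ?thesis using weight_matrix_0[OF M q] by (simp add: circ_seq_def check_seq_def)
  next
    case False
    then have "Max (circ_products (check_seq (M p)) n) \<in> circ_products (check_seq (M p)) n"
      by (intro Max_in finite_circ_products circ_products_nonempty) auto
    then show ?thesis using False bound
      unfolding circ_seq_def by (auto simp: circ_products_def)
  qed
  then show "\<exists>q>0. seq_preceq (circ_seq (check_seq (M p))) (check_seq (M q))"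
    unfolding seq_preceq_def using q B C0(2)
    by (intro exI[of _ q] conjI exI[of _ 1] exI[of _ "C0 * B"]) auto
qed

section \<open>Roots of weight sequences\<close>

text \<open>Since root j A <= max 1 A for every j >= 1, taking j-th roots turns a relation
  \<open>seq_preceq\<close> into an inequality up to one constant.\<close>

lemma root_geometric_bound:
  assumes "j \<ge> 1" "A > 0" "B > 0" "x \<ge> 0"
  shows "root j (A * B ^ j * x) \<le> max 1 A * B * root j x"
proof -
  have "max 1 A ^ 1 \<le> max 1 A ^ j"
    using assms(1) by (intro power_increasing) auto
  then have "A \<le> max 1 A ^ j" by simp
  then have "root j A \<le> root j (max 1 A ^ j)"
    using assms(1) by simp
  also have "\<dots> = max 1 A" using assms(1) by (simp add: real_root_power_cancel)
  finally have A: "root j A \<le> max 1 A" .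
  have "root j (A * B ^ j * x) = root j A * B * root j x"
    using assms by (simp add: real_root_mult real_root_power_cancel)
  also have "\<dots> \<le> max 1 A * B * root j x"
    using A assms by (intro mult_right_mono) (auto intro: real_root_ge_zero)
  finally show ?thesis .
qed

lemma log_convex_seq_pos: "log_convex_seq L \<Longrightarrow> L j > 0"
  by (simp add: log_convex_seq_def)

lemma log_convex_seq_Suc: "log_convex_seq L \<Longrightarrow> (L (Suc j))\<^sup>2 \<le> L j * L (Suc (Suc j))"
  unfolding log_convex_seq_def by (metis One_nat_def Suc_eq_plus1 diff_Suc_1 le_add2)

lemma log_convex_root_mono:
  assumes L: "log_convex_seq L" and L0: "L 0 = 1" and jk: "1 \<le> j" "j \<le> k"
  shows "root j (L j) \<le> root k (L k)"
proof -
  \<comment> \<open>Integer form of the claim for neighbouring indices. Log-convexity raised to the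
    power \<open>Suc j\<close> is combined with the induction hypothesis, and
    \<open>L (Suc j) ^ j\<close> is cancelled; \<open>L 0 = 1\<close> starts the induction.\<close>
  have pow: "L j ^ Suc j \<le> L (Suc j) ^ j" for j
  proof (induction j)
    case (Suc j)
    have pos: "L j > 0" "L (Suc j) > 0" "L (Suc (Suc j)) > 0"
      using log_convex_seq_pos[OF L] by auto
    have "L (Suc j) ^ Suc (Suc j) * L (Suc j) ^ j = ((L (Suc j))\<^sup>2) ^ Suc j"
      by (simp add: power_add[symmetric] power_mult[symmetric] mult_2)
    also have "\<dots> \<le> (L j * L (Suc (Suc j))) ^ Suc j"
      by (intro power_mono log_convex_seq_Suc L) auto
    also have "\<dots> = L j ^ Suc j * L (Suc (Suc j)) ^ Suc j" by (simp only: power_mult_distrib)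
    also have "\<dots> \<le> L (Suc j) ^ j * L (Suc (Suc j)) ^ Suc j"
      using Suc.IH pos by (intro mult_right_mono) auto
    finally have "L (Suc j) ^ Suc (Suc j) * L (Suc j) ^ j \<le> L (Suc (Suc j)) ^ Suc j * L (Suc j) ^ j"
      by (simp only: mult.commute)
    then show ?case using pos by (metis mult_le_cancel_right_pos zero_less_power)
  qed (simp add: L0)
  show ?thesis
    using jk(2)
  proof (induction k rule: dec_induct)
    case (step k)
    have k: "k \<ge> 1" using jk(1) step.hyps by simp
    have pos: "L k > 0" "L (Suc k) > 0" using log_convex_seq_pos[OF L] by auto
    have "(root k (L k)) ^ (k * Suc k) = L k ^ Suc k"
      using k pos by (simp only: power_mult) simp
    also have "\<dots> \<le> L (Suc k) ^ k" by (rule pow)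
    also have "\<dots> = (root (Suc k) (L (Suc k))) ^ (Suc k * k)"
      using pos by (simp only: power_mult real_root_pow_pos zero_less_Suc)
    finally have "(root k (L k)) ^ (k * Suc k) \<le> (root (Suc k) (L (Suc k))) ^ (k * Suc k)"
      by (simp only: mult.commute)
    then have "root k (L k) \<le> root (Suc k) (L (Suc k))"
      using k pos by (subst (asm) power_mono_iff) (auto intro: real_root_ge_zero)
    with step.IH show ?case by linarith
  qed simp
qed

lemma gevrey_seq_pos: "gevrey_seq a j > 0"
  by (simp add: gevrey_seq_def)

lemma gevrey_seq_minus: "gevrey_seq (- a) j * gevrey_seq a j = 1"
  by (simp add: gevrey_seq_def flip: powr_add)

lemma root_gevrey_seq: "j \<ge> 1 \<Longrightarrow> root j (gevrey_seq a j) = real j powr a"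
  by (simp add: gevrey_seq_def root_powr_inverse powr_powr)

lemma seq_equiv_gevrey:
  assumes "seq_equiv (\<lambda>j. gevrey_seq (- a) j * m j) L"
  shows "seq_equiv m (\<lambda>j. gevrey_seq a j * L j)"
proof -
  have eq: "gevrey_seq (- a) j * m j \<le> X * L j \<longleftrightarrow> m j \<le> X * (gevrey_seq a j * L j)"
    "L j \<le> X * (gevrey_seq (- a) j * m j) \<longleftrightarrow> gevrey_seq a j * L j \<le> X * m j" for X j
  proof -
    have g: "gevrey_seq (- a) j = 1 / gevrey_seq a j"
      using gevrey_seq_minus[of a j] gevrey_seq_pos[of a j] by (simp add: field_simps)
    show "gevrey_seq (- a) j * m j \<le> X * L j \<longleftrightarrow> m j \<le> X * (gevrey_seq a j * L j)"
      "L j \<le> X * (gevrey_seq (- a) j * m j) \<longleftrightarrow> gevrey_seq a j * L j \<le> X * m j"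
      using gevrey_seq_pos[of a j] unfolding g by (auto simp: field_simps)
  qed
  show ?thesis
    using assms unfolding seq_equiv_def seq_preceq_def eq .
qed

text \<open>Both factors of the model sequence have nondecreasing roots:
  \<open>real j powr a\<close> because a >= 0, and the normalised \<open>L\<close> by log-convexity.
  Passing to \<open>m\<close> and back costs the constant \<open>c1 * c2\<close>.\<close>

lemma gevrey_log_convex_root_almost_mono:
  assumes a: "a \<ge> 0" and L: "log_convex_seq L" and m: "\<And>j. m j > 0"
    and eqv: "seq_equiv m (\<lambda>j. gevrey_seq a j * L j)"
  obtains C where "C > 0" "\<And>j k. 1 \<le> j \<Longrightarrow> j \<le> k \<Longrightarrow> root j (m j) \<le> C * root k (m k)"
proof -
  \<comment> \<open>Normalised to the value 1 at index 0, as \<open>log_convex_root_mono\<close>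
    requires; the scalar \<open>L 0\<close> moves into the constants of the equivalence.\<close>
  define L' where "L' = (\<lambda>j. L j / L 0)"
  define N where "N = (\<lambda>j. gevrey_seq a j * L' j)"
  have L0: "L 0 > 0" using log_convex_seq_pos[OF L] .
  have L': "log_convex_seq L'"
    using L L0 divide_right_mono[of "(L _)\<^sup>2" _ "(L 0)\<^sup>2"]
    by (auto simp: log_convex_seq_def L'_def power_divide simp flip: power2_eq_square)
  have N: "N j > 0" for j
    using gevrey_seq_pos log_convex_seq_pos[OF L'] by (simp add: N_def)
  have N_eq: "gevrey_seq a j * L j = L 0 * N j" for j
    using L0 by (simp add: N_def L'_def)
  obtain A B where A: "A > 0" and B: "B > 0" and up: "\<And>j. m j \<le> A * B ^ j * (L 0 * N j)"
    using eqv unfolding seq_equiv_def seq_preceq_def N_eq by blast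
  obtain A' B' where A': "A' > 0" and B': "B' > 0" and low: "\<And>j. L 0 * N j \<le> A' * B' ^ j * m j"
    using eqv unfolding seq_equiv_def seq_preceq_def N_eq by blast
  define c1 where "c1 = max 1 (A * L 0) * B"
  define c2 where "c2 = max 1 (A' / L 0) * B'"
  have c: "c1 > 0" "c2 > 0" using B B' by (auto simp: c1_def c2_def)
  have "root j (m j) \<le> (c1 * c2) * root k (m k)" if jk: "1 \<le> j" "j \<le> k" for j k
  proof -
    have "root j (m j) \<le> root j ((A * L 0) * B ^ j * N j)"
      using up[of j] jk by (simp add: mult_ac)
    also have "\<dots> \<le> c1 * root j (N j)"
      unfolding c1_def using A B L0 N[of j] jk by (intro root_geometric_bound) auto
    also have "root j (N j) = real j powr a * root j (L' j)"
      using jk by (simp add: N_def real_root_mult root_gevrey_seq)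
    also have "c1 * (real j powr a * root j (L' j)) \<le> c1 * (real k powr a * root k (L' k))"
      using jk a c log_convex_seq_pos[OF L'] L0
      by (intro mult_left_mono mult_mono log_convex_root_mono[OF L'] powr_mono2)
         (auto simp: L'_def intro!: real_root_ge_zero less_imp_le)
    also have "real k powr a * root k (L' k) = root k (N k)"
      using jk by (simp add: N_def real_root_mult root_gevrey_seq)
    also have "root k (N k) \<le> root k ((A' / L 0) * B' ^ k * m k)"
      using low[of k] L0 jk by (simp add: field_simps)
    also have "\<dots> \<le> c2 * root k (m k)"
      unfolding c2_def using A' B' L0 m[of k] jk by (intro root_geometric_bound) auto
    finally show ?thesis using c by (simp add: mult_ac)
  qed
  then show thesis using that[of "c1 * c2"] c by simp
qed

lemma root_fact_le: "k \<ge> 1 \<Longrightarrow> root k (fact k) \<le> real k"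
proof -
  assume k: "k \<ge> 1"
  have "root k (fact k) \<le> root k (real k ^ k)"
    using k fact_le_power[of k, where 'a = real] by simp
  then show ?thesis using k by (simp add: real_root_power_cancel)
qed

lemma le_root_fact: "n \<ge> 1 \<Longrightarrow> real n \<le> exp 1 * root n (fact n)"
proof -
  assume n: "n \<ge> 1"
  \<comment> \<open>n ^ n / n! is a single term of the exponential series at
    \<open>n\<close>.\<close>
  have "(\<Sum>k\<in>{n}. real n ^ k /\<^sub>R fact k) \<le> exp (real n)"
    unfolding exp_def by (intro sum_le_suminf summable_exp_generic) auto
  then have "real n ^ n \<le> exp (real n) * fact n"
    by (simp add: field_simps)
  also have "exp (real n) = exp 1 ^ n" by (simp flip: exp_of_nat_mult)
  finally have "root n (real n ^ n) \<le> root n (exp 1 ^ n * fact n)"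
    using n by simp
  then show ?thesis using n by (simp add: real_root_mult real_root_power_cancel)
qed

text \<open>Passing from multiples \<open>j * l\<close> to all \<open>k \<ge> j\<close> costs at most a factor \<open>2\<close> in \<open>root k (fact k)\<close>,
  since \<open>j * l \<le> k < 2 * (j * l)\<close> for \<open>l = k div j\<close>.\<close>

lemma rai_if_power_bound:
  assumes M: "weight_matrix M"
    and reg: "\<And>q. q > 0 \<Longrightarrow> \<exists>C>0. \<forall>j k. 1 \<le> j \<and> j \<le> k \<longrightarrow> root j (M q j) \<le> C * root k (M q k)"
    and pow: "\<And>p. p > 0 \<Longrightarrow> \<exists>q>0. \<exists>D>0. \<forall>j\<ge>1. \<forall>l\<ge>1.
        check_seq (M p) j ^ l \<le> D ^ (j * l) * check_seq (M q) (j * l)"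
  shows "matrix_rai M"
  unfolding matrix_rai_def
proof (intro allI impI)
  fix p :: real assume p: "p > 0"
  obtain q D where q: "q > 0" and D: "D > 0"
    and b: "\<And>j l. j \<ge> 1 \<Longrightarrow> l \<ge> 1 \<Longrightarrow> check_seq (M p) j ^ l \<le> D ^ (j * l) * check_seq (M q) (j * l)"
    using pow[OF p] by blast
  obtain C where C: "C > 0"
    and r: "\<And>j k. 1 \<le> j \<Longrightarrow> j \<le> k \<Longrightarrow> root j (M q j) \<le> C * root k (M q k)"
    using reg[OF q] by blast
  have "root j (check_seq (M p) j) \<le> (D * C * (2 * exp 1)) * root k (check_seq (M q) k)"
    if jk: "1 \<le> j" "j \<le> k" for j k
  proof -
    define l n where "l = k div j" and "n = j * l"
    have l: "l \<ge> 1" using jk by (simp add: l_def div_greater_zero_iff Suc_le_eq)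
    have n1: "n \<ge> 1" using jk l by (simp add: n_def)
    have nk: "n \<le> k" by (simp add: n_def l_def)
    have "k = n + k mod j" by (simp add: n_def l_def)
    moreover have "k mod j < j" using jk by simp
    moreover have "j \<le> n" using l by (simp add: n_def)
    ultimately have k2: "k \<le> 2 * n" by linarith
    have pos: "check_seq (M p) j > 0" "M q n > 0" "M q k > 0"
      using check_seq_weight_pos[OF M p] weight_matrix_pos[OF M q] by auto
    have "root j (check_seq (M p) j) = root n (check_seq (M p) j ^ l)"
      using jk l pos by (simp add: n_def real_root_mult_exp real_root_power real_root_pos_pos_le
          real_root_power_cancel flip: mult.commute[of l j])
    also have "\<dots> \<le> root n (D ^ n * check_seq (M q) n)"
      using b[OF jk(1) l] n1 by (simp add: n_def)
    also have "\<dots> = D * (root n (M q n) / root n (fact n))"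
      using D n1 by (simp add: check_seq_def real_root_mult real_root_divide real_root_power_cancel)
    \<comment> \<open>Almost monotonicity of roots is available for \<open>M q\<close>, not for
      \<open>check_seq (M q)\<close>, so the factorials are split off and compared separately
      through \<open>n\<close> and \<open>k\<close>.\<close>
    also have "\<dots> \<le> D * ((C * root k (M q k)) / (real n / exp 1))"
      using r[OF n1 nk] D C n1 pos le_root_fact[OF n1]
      by (intro mult_left_mono frac_le) (auto simp: field_simps intro!: mult_nonneg_nonneg real_root_ge_zero)
    also have "\<dots> = D * C * exp 1 * (root k (M q k) / real n)"
      by simp
    also have "\<dots> \<le> D * C * exp 1 * (root k (M q k) * (2 / root k (fact k)))"
    proof -
      have "root k (fact k) \<le> 2 * real n"
        using root_fact_le[of k] k2 jk by linarith
      moreover have "root k (fact k) > 0" using jk by (simp add: real_root_gt_zero)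
      ultimately have "1 / real n \<le> 2 / root k (fact k)"
        using n1 by (simp add: field_simps)
      then have "root k (M q k) * (1 / real n) \<le> root k (M q k) * (2 / root k (fact k))"
        using pos by (intro mult_left_mono real_root_ge_zero) auto
      then show ?thesis using D C by (intro mult_left_mono) auto
    qed
    also have "\<dots> = (D * C * (2 * exp 1)) * root k (check_seq (M q) k)"
      by (simp add: check_seq_def real_root_divide)
    finally show ?thesis .
  qed
  then show "\<exists>C>0. \<exists>q>0. \<forall>j k. 1 \<le> j \<and> j \<le> k \<longrightarrow>
        root j (check_seq (M p) j) \<le> C * root k (check_seq (M q) k)"
    using q D C by (intro exI[of _ "D * C * (2 * exp 1)"] conjI exI[of _ q]) auto
qed

section \<open>Rotated Laplace integrals\<close>

lemma norm_exp_diff_le: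
  fixes a b :: complex
  assumes "Re a \<le> 0" "Re b \<le> 0"
  shows "norm (exp a - exp b) \<le> norm (a - b)"
proof -
  have "norm (exp a - exp b) \<le> 1 * norm (a - b)"
  proof (rule field_differentiable_bound[of "{z. Re z \<le> 0}" exp exp])
    show "convex {z. Re z \<le> 0}" by (rule convex_halfspace_Re_le)
  qed (use assms in \<open>auto intro: derivative_eq_intros\<close>)
  then show ?thesis by simp
qed

text \<open>On the open set \<open>H\<close> all exponents have nonpositive real part, so
  \<open>norm_exp_diff_le\<close> dominates every difference quotient by the integrable function
  \<open>s x * g x\<close>.\<close>

lemma has_field_derivative_laplace:
  fixes N :: "'a measure" and g s :: "'a \<Rightarrow> complex"
  assumes g: "integrable N g" and sg: "integrable N (\<lambda>x. s x * g x)"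
    and s [measurable]: "s \<in> borel_measurable N"
    and H: "open H" "z0 \<in> H" and re: "\<And>z x. z \<in> H \<Longrightarrow> Re (z * s x) \<ge> 0"
  shows "((\<lambda>z. \<integral>x. exp (- (z * s x)) * g x \<partial>N) has_field_derivative
           - (\<integral>x. exp (- (z0 * s x)) * (s x * g x) \<partial>N)) (at z0)"
proof -
  have [measurable]: "g \<in> borel_measurable N" using g by simp
  have int: "integrable N (\<lambda>x. exp (- (z * s x)) * g x)" if "z \<in> H" for z
  proof (rule Bochner_Integration.integrable_bound[OF g])
    show "AE x in N. norm (exp (- (z * s x)) * g x) \<le> norm (g x)"
      using re[OF that] by (intro AE_I2) (simp add: norm_mult mult_left_le_one_le)
  qed auto
  define F where "F = (\<lambda>z. \<integral>x. exp (- (z * s x)) * g x \<partial>N)"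
  have "((\<lambda>z. (F z - F z0) / (z - z0)) \<longlongrightarrow> - (\<integral>x. exp (- (z0 * s x)) * (s x * g x) \<partial>N)) (at z0 within H)"
    unfolding tendsto_at_iff_sequentially
  proof (intro allI impI)
    fix X assume X: "\<forall>i. X i \<in> H - {z0}" "X \<longlonglongrightarrow> z0"
    define q where "q = (\<lambda>i x. (exp (- (X i * s x)) - exp (- (z0 * s x))) / (X i - z0) * g x)"
    have lim: "(\<lambda>i. \<integral>x. q i x \<partial>N) \<longlonglongrightarrow> (\<integral>x. - (exp (- (z0 * s x)) * (s x * g x)) \<partial>N)"
    proof (rule integral_dominated_convergence)
      show "integrable N (\<lambda>x. norm (s x * g x))" using sg by simp
      show "AE x in N. (\<lambda>i. q i x) \<longlonglongrightarrow> - (exp (- (z0 * s x)) * (s x * g x))"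
      proof (rule AE_I2)
        fix x
        have "((\<lambda>z. exp (- (z * s x))) has_field_derivative - (exp (- (z0 * s x)) * s x)) (at z0)"
          by (auto intro!: derivative_eq_intros)
        then have "((\<lambda>z. (exp (- (z * s x)) - exp (- (z0 * s x))) / (z - z0))
            \<longlongrightarrow> - (exp (- (z0 * s x)) * s x)) (at z0)"
          by (simp add: has_field_derivative_iff)
        then have "(\<lambda>i. (exp (- (X i * s x)) - exp (- (z0 * s x))) / (X i - z0))
            \<longlonglongrightarrow> - (exp (- (z0 * s x)) * s x)"
          using X unfolding tendsto_at_iff_sequentially o_def by auto
        from tendsto_mult_right[OF this, of "g x"]
        show "(\<lambda>i. q i x) \<longlonglongrightarrow> - (exp (- (z0 * s x)) * (s x * g x))"
          by (simp add: q_def mult_ac)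
      qed
      show "AE x in N. norm (q i x) \<le> norm (s x * g x)" for i
      proof (rule AE_I2)
        fix x
        have X': "X i \<in> H" "X i \<noteq> z0" using X by auto
        have "norm (exp (- (X i * s x)) - exp (- (z0 * s x))) \<le> norm (- (X i * s x) - - (z0 * s x))"
          using re[OF X'(1), of x] re[OF H(2), of x] by (intro norm_exp_diff_le) auto
        also have "- (X i * s x) - - (z0 * s x) = - ((X i - z0) * s x)" by (simp add: algebra_simps)
        finally have "norm ((exp (- (X i * s x)) - exp (- (z0 * s x))) / (X i - z0)) \<le> norm (s x)"
          using X'(2) by (simp add: norm_divide norm_mult divide_le_eq mult.commute)
        then show "norm (q i x) \<le> norm (s x * g x)"
          unfolding q_def norm_mult by (intro mult_right_mono) auto
      qed
    qed (auto simp: q_def)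
    have "(\<integral>x. q i x \<partial>N) = (F (X i) - F z0) / (X i - z0)" for i
    proof -
      have X': "X i \<in> H" using X by auto
      have "q i x = (exp (- (X i * s x)) * g x - exp (- (z0 * s x)) * g x) / (X i - z0)" for x
        by (simp add: q_def diff_divide_distrib algebra_simps)
      then show ?thesis
        using int[OF X'] int[OF H(2)] by (simp add: F_def)
    qed
    with lim show "((\<lambda>z. (F z - F z0) / (z - z0)) \<circ> X)
        \<longlonglongrightarrow> - (\<integral>x. exp (- (z0 * s x)) * (s x * g x) \<partial>N)"
      by (simp add: o_def)
  qed
  then show ?thesis
    using H by (simp add: has_field_derivative_iff F_def at_within_open[of z0 H])
qed

section \<open>Estimates for the damped Laplace kernel\<close>

lemma exp_linear_minus_exp_le:
  fixes \<kappa> d m v :: real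
  assumes \<kappa>: "\<kappa> > 0" and d: "d > 0" and m: "m > 0"
  shows "exp (m * v - d * exp (\<kappa> * v)) \<le> (m / (\<kappa> * d)) powr (m / \<kappa>)"
proof -
  \<comment> \<open>\<open>y\<close> is \<kappa> times the maximiser of m v - d exp (\<kappa> v);
    the estimate is the tangent inequality for exp at that point.\<close>
  define y where "y = ln (m / (\<kappa> * d))"
  have ey: "d * exp y = m / \<kappa>" using assms by (simp add: y_def)
  have "1 + (\<kappa> * v - y) \<le> exp (\<kappa> * v - y)" by (rule exp_ge_add_one_self)
  then have "m / \<kappa> * (1 + (\<kappa> * v - y)) \<le> m / \<kappa> * exp (\<kappa> * v - y)"
    using assms by (intro mult_left_mono) auto
  also have "\<dots> = d * exp (\<kappa> * v)"
    unfolding ey[symmetric] by (simp add: exp_diff)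
  finally have "m * v - d * exp (\<kappa> * v) \<le> m / \<kappa> * y - m / \<kappa>"
    using \<kappa> by (simp add: field_simps)
  also have "\<dots> \<le> m / \<kappa> * y" using assms by simp
  finally show ?thesis
    using assms by (simp add: powr_def y_def)
qed

lemma gevrey_seq_ge_1: "a \<ge> 0 \<Longrightarrow> gevrey_seq a j \<ge> 1"
  by (simp add: gevrey_seq_def ge_one_powr_ge_zero)

text \<open>For v > 0 the exponent Suc j * v is written as 2 v + j v - v. Half of the damping turns
  exp (2 v) into a constant, the other half turns exp (j v) into the growth j^(j / \<kappa>), and
  exp (- v) remains. For v <= 0 the factor exp (Suc j * v) already decays.\<close>

lemma kernel_bound:
  fixes \<kappa> c :: real
  assumes \<kappa>: "\<kappa> > 0" and c: "c > 0"
  obtains C h where "C > 0" "h > 0"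
    "\<And>j v. exp (real (Suc j) * v - c * exp (\<kappa> * v)) \<le> C * h ^ j * gevrey_seq (1 / \<kappa>) j * exp (- \<bar>v\<bar>)"
proof -
  define C where "C = max 1 ((2 / (\<kappa> * (c / 2))) powr (2 / \<kappa>))"
  define h where "h = max 1 ((1 / (\<kappa> * (c / 2))) powr (1 / \<kappa>))"
  have C: "C \<ge> 1" and h: "h \<ge> 1" by (auto simp: C_def h_def)
  have "exp (real (Suc j) * v - c * exp (\<kappa> * v)) \<le> C * h ^ j * gevrey_seq (1 / \<kappa>) j * exp (- \<bar>v\<bar>)" for j v
  proof (cases "v \<le> 0")
    case True
    have "exp (real (Suc j) * v - c * exp (\<kappa> * v)) \<le> exp (real (Suc j) * v)"
      using c by simp
    also have "\<dots> \<le> 1 * exp (- \<bar>v\<bar>)"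
      using True mult_nonneg_nonpos[of "real j" v] by (simp add: algebra_simps)
    also have "\<dots> \<le> C * h ^ j * gevrey_seq (1 / \<kappa>) j * exp (- \<bar>v\<bar>)"
    proof (rule mult_right_mono)
      have "1 * 1 * 1 \<le> C * h ^ j * gevrey_seq (1 / \<kappa>) j"
        using C h \<kappa> by (intro mult_mono one_le_power gevrey_seq_ge_1) auto
      then show "1 \<le> C * h ^ j * gevrey_seq (1 / \<kappa>) j" by simp
    qed auto
    finally show ?thesis .
  next
    case False
    have 1: "exp (2 * v - c / 2 * exp (\<kappa> * v)) \<le> C"
      using exp_linear_minus_exp_le[of \<kappa> "c / 2" 2 v] \<kappa> c by (simp add: C_def)
    have 2: "exp (real j * v - c / 2 * exp (\<kappa> * v)) \<le> h ^ j * gevrey_seq (1 / \<kappa>) j"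
    proof (cases "j = 0")
      case True
      then show ?thesis using c by (simp add: gevrey_seq_def)
    next
      case False
      then have "exp (real j * v - c / 2 * exp (\<kappa> * v))
          \<le> (real j / (\<kappa> * (c / 2))) powr (real j / \<kappa>)"
        using \<kappa> c by (intro exp_linear_minus_exp_le) auto
      also have "\<dots> = (real j * (1 / (\<kappa> * (c / 2)))) powr (real j * (1 / \<kappa>))" by simp
      also have "\<dots> = real j powr (real j * (1 / \<kappa>)) * ((1 / (\<kappa> * (c / 2))) powr (1 / \<kappa>)) ^ j"
        using \<kappa> c False by (subst powr_mult) (auto simp: powr_powr mult.commute simp flip: powr_realpow)
      also have "\<dots> \<le> real j powr (real j * (1 / \<kappa>)) * h ^ j"
        unfolding h_def by (intro mult_left_mono power_mono) auto
      finally show ?thesis using False by (simp add: gevrey_seq_def mult.commute)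
    qed
    have "exp (real (Suc j) * v - c * exp (\<kappa> * v)) =
        exp (2 * v - c / 2 * exp (\<kappa> * v)) * exp (real j * v - c / 2 * exp (\<kappa> * v)) * exp (- \<bar>v\<bar>)"
      using False by (simp add: algebra_simps flip: exp_add)
    also have "\<dots> \<le> C * (h ^ j * gevrey_seq (1 / \<kappa>) j) * exp (- \<bar>v\<bar>)"
      using 1 2 C by (intro mult_mono mult_right_mono) auto
    finally show ?thesis by (simp add: mult_ac)
  qed
  then show thesis using that[of C h] C h by auto
qed

lemma integrable_exp_minus_abs: "integrable lborel (\<lambda>v::real. exp (- \<bar>v\<bar>))"
proof -
  have "integrable lborel (\<lambda>v::real. 2 * inverse (1 + v\<^sup>2))"
    using integrable_inverse_1_plus_square by (simp add: set_integrable_def einterval_def)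
  moreover have "norm (exp (- \<bar>v\<bar>)) \<le> norm (2 * inverse (1 + v\<^sup>2))" for v :: real
  proof -
    have "1 + v\<^sup>2 \<le> 2 * exp \<bar>v\<bar>"
      using exp_lower_Taylor_quadratic[of "\<bar>v\<bar>"] by simp
    moreover have "1 + v\<^sup>2 > 0" by (simp add: add_pos_nonneg)
    ultimately show ?thesis
      by (simp add: exp_minus field_simps)
  qed
  ultimately show ?thesis
    by (intro Bochner_Integration.integrable_bound[where g = "\<lambda>v::real. exp (- \<bar>v\<bar>)"
          and f = "\<lambda>v. 2 * inverse (1 + v\<^sup>2)"] AE_I2) auto
qed

text \<open>Along \<open>Im u = \<theta>\<close> the integral of the kernel over \<open>u\<close> is
  \<open>\<integral> s^j exp (- z s) exp (- s^\<kappa>) ds\<close> over the ray \<open>arg s = \<theta>\<close>, where \<open>z = exp w\<close> and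
  \<open>s = exp u\<close>.\<close>

definition laplace_kernel :: "real \<Rightarrow> nat \<Rightarrow> complex \<Rightarrow> complex \<Rightarrow> complex" where
  "laplace_kernel \<kappa> j w u = exp (of_nat (Suc j) * u - exp (w + u) - exp (of_real \<kappa> * u))"

lemma kernel_holomorphic: "laplace_kernel \<kappa> j w holomorphic_on UNIV"
  unfolding laplace_kernel_def by (intro holomorphic_intros)

text \<open>For s = exp (v + i \<theta>) the real part of s^\<kappa> is exp (\<kappa> v) cos
  (\<kappa> \<theta>), and the cosine is smallest at the extreme angle.\<close>

lemma norm_damping_le:
  assumes \<theta>: "\<bar>\<theta>\<bar> \<le> \<theta>\<^sub>0" and \<kappa>: "\<kappa> > 0" "\<kappa> * \<theta>\<^sub>0 < pi / 2"
  shows "norm (exp (of_nat (Suc j) * (of_real v + \<i> * of_real \<theta>)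
             - exp (of_real \<kappa> * (of_real v + \<i> * of_real \<theta>))))
           \<le> exp (real (Suc j) * v - cos (\<kappa> * \<theta>\<^sub>0) * exp (\<kappa> * v))"
proof -
  have "\<kappa> * \<theta>\<^sub>0 \<le> pi" using \<kappa>(2) pi_gt_zero by linarith
  then have "cos (\<kappa> * \<theta>\<^sub>0) \<le> cos (\<kappa> * \<bar>\<theta>\<bar>)"
    using \<theta> \<kappa> by (intro cos_monotone_0_pi_le) (auto intro: mult_left_mono)
  also have "\<kappa> * \<bar>\<theta>\<bar> = \<bar>\<kappa> * \<theta>\<bar>" using \<kappa> by (simp add: abs_mult)
  finally have "cos (\<kappa> * \<theta>\<^sub>0) \<le> cos (\<kappa> * \<theta>)" by simp
  then have "cos (\<kappa> * \<theta>\<^sub>0) * exp (\<kappa> * v) \<le> Re (exp (of_real \<kappa> * (of_real v + \<i> * of_real \<theta>)))"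
    by (simp add: Re_exp)
  then show ?thesis
    unfolding norm_exp_eq_Re by (simp add: algebra_simps)
qed

lemma norm_kernel_le:
  assumes w: "\<bar>Im w + \<theta>\<bar> \<le> pi / 2" and \<theta>: "\<bar>\<theta>\<bar> \<le> \<theta>\<^sub>0" and \<kappa>: "\<kappa> > 0" "\<kappa> * \<theta>\<^sub>0 < pi / 2"
  shows "norm (laplace_kernel \<kappa> j w (of_real v + \<i> * of_real \<theta>))
           \<le> exp (real (Suc j) * v - cos (\<kappa> * \<theta>\<^sub>0) * exp (\<kappa> * v))"
proof -
  define u where "u = of_real v + \<i> * complex_of_real \<theta>"
  have "cos (Im w + \<theta>) \<ge> 0"
    using w by (intro cos_ge_zero) linarith+
  \<comment> \<open>The product z s lies in the closed right half-plane, so exp (- z s) has modulus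
    at most 1.\<close>
  then have "Re (exp (w + u)) \<ge> 0"
    by (simp add: Re_exp u_def)
  then have "norm (laplace_kernel \<kappa> j w u) \<le> norm (exp (of_nat (Suc j) * u - exp (of_real \<kappa> * u)))"
    unfolding laplace_kernel_def norm_exp_eq_Re by simp
  also have "\<dots> \<le> exp (real (Suc j) * v - cos (\<kappa> * \<theta>\<^sub>0) * exp (\<kappa> * v))"
    unfolding u_def by (rule norm_damping_le[OF \<theta> \<kappa>])
  finally show ?thesis by (simp add: u_def)
qed

lemma cos_pos_if: "\<kappa> > 0 \<Longrightarrow> \<theta>\<^sub>0 \<ge> 0 \<Longrightarrow> \<kappa> * \<theta>\<^sub>0 < pi / 2 \<Longrightarrow> cos (\<kappa> * \<theta>\<^sub>0) > 0" for \<kappa> \<theta>\<^sub>0 :: real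
  by (rule cos_gt_zero_pi) (auto intro: order_less_le_trans[of _ 0])

text \<open>Uniformity in the angle serves the contour shift, whose vertical segments sweep a range
  of angles; uniformity in \<open>w\<close> gives bounds on the whole sector.\<close>

lemma kernel_uniform_bound:
  assumes \<kappa>: "\<kappa> > 0" "\<theta>\<^sub>0 \<ge> 0" "\<kappa> * \<theta>\<^sub>0 < pi / 2"
  obtains C h where "C > 0" "h > 0"
    "\<And>j w \<theta> v. \<bar>Im w + \<theta>\<bar> \<le> pi / 2 \<Longrightarrow> \<bar>\<theta>\<bar> \<le> \<theta>\<^sub>0 \<Longrightarrow>
       norm (laplace_kernel \<kappa> j w (of_real v + \<i> * of_real \<theta>))
         \<le> C * h ^ j * gevrey_seq (1 / \<kappa>) j * exp (- \<bar>v\<bar>)"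
proof -
  obtain C h where C: "C > 0" and h: "h > 0"
    and b: "\<And>j v. exp (real (Suc j) * v - cos (\<kappa> * \<theta>\<^sub>0) * exp (\<kappa> * v))
              \<le> C * h ^ j * gevrey_seq (1 / \<kappa>) j * exp (- \<bar>v\<bar>)"
    using kernel_bound[OF \<kappa>(1) cos_pos_if[OF \<kappa>]] by metis
  show thesis
    by (rule that[OF C h]) (rule order_trans[OF norm_kernel_le[OF _ _ \<kappa>(1,3)] b])
qed

lemma integrable_exp_linear_minus_exp:
  fixes \<kappa> c :: real
  assumes "\<kappa> > 0" "c > 0"
  shows "integrable lborel (\<lambda>v. exp (real (Suc j) * v - c * exp (\<kappa> * v)))"
proof -
  obtain C h where b: "\<And>j v. exp (real (Suc j) * v - c * exp (\<kappa> * v))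
              \<le> C * h ^ j * gevrey_seq (1 / \<kappa>) j * exp (- \<bar>v\<bar>)"
    using kernel_bound[OF assms] by metis
  show ?thesis
  proof (rule Bochner_Integration.integrable_bound)
    show "integrable lborel (\<lambda>v. C * h ^ j * gevrey_seq (1 / \<kappa>) j * exp (- \<bar>v\<bar>))"
      by (intro integrable_mult_right integrable_exp_minus_abs)
    show "AE v in lborel. norm (exp (real (Suc j) * v - c * exp (\<kappa> * v)))
        \<le> norm (C * h ^ j * gevrey_seq (1 / \<kappa>) j * exp (- \<bar>v\<bar>))"
      by (intro AE_I2) (metis b abs_ge_self abs_exp_cancel order_trans real_norm_def)
  qed measurable
qed

lemma continuous_imp_borel_measurable_lborel:
  "continuous_on UNIV f \<Longrightarrow> f \<in> borel_measurable lborel"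
  by (simp add: borel_measurable_continuous_onI)

lemma damping_integrable:
  assumes \<kappa>: "\<kappa> > 0" "\<kappa> * \<theta>\<^sub>0 < pi / 2" and \<theta>: "\<bar>\<theta>\<bar> \<le> \<theta>\<^sub>0"
  shows "integrable lborel (\<lambda>v. exp (of_nat (Suc j) * (of_real v + \<i> * of_real \<theta>)
             - exp (of_real \<kappa> * (of_real v + \<i> * of_real \<theta>))))" (is "integrable _ ?f")
proof (rule Bochner_Integration.integrable_bound)
  have c: "cos (\<kappa> * \<theta>\<^sub>0) > 0" using \<kappa> \<theta> by (intro cos_pos_if) auto
  show "integrable lborel (\<lambda>v. exp (real (Suc j) * v - cos (\<kappa> * \<theta>\<^sub>0) * exp (\<kappa> * v)))"
    by (rule integrable_exp_linear_minus_exp[OF \<kappa>(1) c])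
  show "?f \<in> borel_measurable lborel"
    by (intro continuous_imp_borel_measurable_lborel continuous_intros)
qed (use norm_damping_le[OF \<theta> \<kappa>] in auto)

lemma kernel_integrable:
  assumes \<kappa>: "\<kappa> > 0" "\<kappa> * \<theta>\<^sub>0 < pi / 2" and w: "\<bar>Im w + \<theta>\<bar> \<le> pi / 2" and \<theta>: "\<bar>\<theta>\<bar> \<le> \<theta>\<^sub>0"
  shows "integrable lborel (\<lambda>v. laplace_kernel \<kappa> j w (of_real v + \<i> * of_real \<theta>))"
    (is "integrable _ ?f")
proof (rule Bochner_Integration.integrable_bound)
  have c: "cos (\<kappa> * \<theta>\<^sub>0) > 0" using \<kappa> \<theta> by (intro cos_pos_if) auto
  show "integrable lborel (\<lambda>v. exp (real (Suc j) * v - cos (\<kappa> * \<theta>\<^sub>0) * exp (\<kappa> * v)))"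
    by (rule integrable_exp_linear_minus_exp[OF \<kappa>(1) c])
  show "?f \<in> borel_measurable lborel"
    unfolding laplace_kernel_def
    by (intro continuous_imp_borel_measurable_lborel continuous_intros)
qed (use norm_kernel_le[OF w \<theta> \<kappa>] in auto)

text \<open>Contour shift: if \<open>Q\<close> is a primitive of the kernel, the integrals over \<open>{-n..n}\<close> along the two
  lines differ by two increments of \<open>Q\<close> along vertical segments, which decay with the kernel.\<close>

lemma kernel_integral_shift:
  assumes \<kappa>: "\<kappa> > 0" "\<kappa> * \<theta>\<^sub>0 < pi / 2"
    and 1: "\<bar>Im w + \<theta>\<^sub>1\<bar> \<le> pi / 2" "\<bar>\<theta>\<^sub>1\<bar> \<le> \<theta>\<^sub>0"
    and 2: "\<bar>Im w + \<theta>\<^sub>2\<bar> \<le> pi / 2" "\<bar>\<theta>\<^sub>2\<bar> \<le> \<theta>\<^sub>0"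
  shows "(\<integral>v. laplace_kernel \<kappa> j w (of_real v + \<i> * of_real \<theta>\<^sub>1) \<partial>lborel) =
         (\<integral>v. laplace_kernel \<kappa> j w (of_real v + \<i> * of_real \<theta>\<^sub>2) \<partial>lborel)"
proof -
  have \<theta>0: "\<theta>\<^sub>0 \<ge> 0" using 1(2) by linarith
  obtain C h where C: "C > 0" "h > 0" and b: "\<And>j w \<theta> v. \<bar>Im w + \<theta>\<bar> \<le> pi / 2 \<Longrightarrow> \<bar>\<theta>\<bar> \<le> \<theta>\<^sub>0 \<Longrightarrow>
       norm (laplace_kernel \<kappa> j w (of_real v + \<i> * of_real \<theta>))
         \<le> C * h ^ j * gevrey_seq (1 / \<kappa>) j * exp (- \<bar>v\<bar>)"
    using kernel_uniform_bound[OF \<kappa>(1) \<theta>0 \<kappa>(2)] by metis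
  define B where "B = C * h ^ j * gevrey_seq (1 / \<kappa>) j"
  obtain Q where Q: "\<And>u. (Q has_field_derivative laplace_kernel \<kappa> j w u) (at u)"
    using holomorphic_convex_primitive'[OF convex_UNIV open_UNIV kernel_holomorphic[of \<kappa> j w]]
    by auto
  define P where "P = (\<lambda>\<theta> v. laplace_kernel \<kappa> j w (of_real v + \<i> * of_real \<theta>))"
  define q where "q = (\<lambda>\<theta> v. Q (of_real v + \<i> * of_real \<theta>))"
  have contP: "continuous_on A (P \<theta>)" for A \<theta>
    unfolding P_def laplace_kernel_def by (intro continuous_intros)
  have lim: "(\<lambda>n. q \<theta> (real n) - q \<theta> (- real n)) \<longlonglongrightarrow> (\<integral>v. P \<theta> v \<partial>lborel)"
    if \<theta>: "\<bar>Im w + \<theta>\<bar> \<le> pi / 2" "\<bar>\<theta>\<bar> \<le> \<theta>\<^sub>0" for \<theta>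
  proof -
    have "(\<integral>v. indicator {- real n .. real n} v *\<^sub>R P \<theta> v \<partial>lborel) = q \<theta> (real n) - q \<theta> (- real n)" for n
    proof (rule integral_FTC_Icc[where F = "q \<theta>"])
      fix v
      have "((\<lambda>v. Q (of_real v + \<i> * of_real \<theta>)) has_vector_derivative
          1 * laplace_kernel \<kappa> j w (of_real v + \<i> * of_real \<theta>)) (at v)"
      proof (rule field_vector_diff_chain_at[where g = Q and f = "\<lambda>v. of_real v + \<i> * of_real \<theta>",
            unfolded o_def])
        show "((\<lambda>v. of_real v + \<i> * of_real \<theta>) has_vector_derivative 1) (at v)"
          by (auto intro!: derivative_eq_intros)
      qed (rule Q)
      then show "(q \<theta> has_vector_derivative P \<theta> v) (at v within {- real n..real n})"
        unfolding q_def P_def by (simp add: has_vector_derivative_at_within)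
    qed (auto intro: contP)
    moreover have "(\<lambda>n. \<integral>v. indicator {- real n .. real n} v *\<^sub>R P \<theta> v \<partial>lborel) \<longlonglongrightarrow> (\<integral>v. P \<theta> v \<partial>lborel)"
    proof (rule integral_dominated_convergence)
      have intP: "integrable lborel (P \<theta>)"
        unfolding P_def by (rule kernel_integrable[OF \<kappa> \<theta>])
      then show "integrable lborel (\<lambda>v. norm (P \<theta> v))" by simp
      show "P \<theta> \<in> borel_measurable lborel" using intP by simp
      then show "(\<lambda>v. indicator {- real n..real n} v *\<^sub>R P \<theta> v) \<in> borel_measurable lborel" for n
        by measurable
      show "AE v in lborel. (\<lambda>n. indicator {- real n..real n} v *\<^sub>R P \<theta> v) \<longlonglongrightarrow> P \<theta> v"
      proof (rule AE_I2)
        fix v :: real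
        obtain N where N: "\<bar>v\<bar> \<le> real N" using real_arch_simple by blast
        have "\<forall>\<^sub>F n in sequentially. P \<theta> v = indicator {- real n..real n} v *\<^sub>R P \<theta> v"
          unfolding eventually_sequentially
          by (rule exI[of _ N]) (use N in \<open>auto simp: indicator_def abs_le_iff\<close>)
        then show "(\<lambda>n. indicator {- real n..real n} v *\<^sub>R P \<theta> v) \<longlonglongrightarrow> P \<theta> v"
          by (rule tendsto_eventually[OF eventually_mono]) auto
      qed
      show "AE v in lborel. norm (indicator {- real n..real n} v *\<^sub>R P \<theta> v) \<le> norm (P \<theta> v)" for n
        by (rule AE_I2) (auto simp: indicator_def)
    qed
    ultimately show ?thesis by simp
  qed
  have vert: "norm (q \<theta>\<^sub>2 v - q \<theta>\<^sub>1 v) \<le> B * exp (- \<bar>v\<bar>) * \<bar>\<theta>\<^sub>2 - \<theta>\<^sub>1\<bar>" for v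
  proof -
    define S where "S = closed_segment \<theta>\<^sub>1 \<theta>\<^sub>2"
    \<comment> \<open>The admissible angles form an interval, so the kernel bound holds along the
      whole vertical segment.\<close>
    have S: "\<bar>Im w + \<theta>\<bar> \<le> pi / 2 \<and> \<bar>\<theta>\<bar> \<le> \<theta>\<^sub>0" if "\<theta> \<in> S" for \<theta>
    proof -
      have "\<theta>\<^sub>1 \<le> \<theta> \<and> \<theta> \<le> \<theta>\<^sub>2 \<or> \<theta>\<^sub>2 \<le> \<theta> \<and> \<theta> \<le> \<theta>\<^sub>1"
        using that unfolding S_def closed_segment_eq_real_ivl by (auto split: if_splits)
      then show ?thesis using 1 2 by (smt (verit))
    qed
    define u where "u = (\<lambda>\<theta>. of_real v + \<i> * complex_of_real \<theta>)"
    have "norm (Q (u \<theta>\<^sub>2) - Q (u \<theta>\<^sub>1)) \<le> B * exp (- \<bar>v\<bar>) * norm (u \<theta>\<^sub>2 - u \<theta>\<^sub>1)"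
    proof (rule field_differentiable_bound[of "closed_segment (u \<theta>\<^sub>1) (u \<theta>\<^sub>2)"])
      fix z assume "z \<in> closed_segment (u \<theta>\<^sub>1) (u \<theta>\<^sub>2)"
      then obtain t where t: "0 \<le> t" "t \<le> 1" "z = (1 - t) *\<^sub>R u \<theta>\<^sub>1 + t *\<^sub>R u \<theta>\<^sub>2"
        by (auto simp: closed_segment_def)
      define \<theta> where "\<theta> = (1 - t) *\<^sub>R \<theta>\<^sub>1 + t *\<^sub>R \<theta>\<^sub>2"
      have z: "z = u \<theta>" by (simp add: t(3) u_def \<theta>_def scaleR_conv_of_real algebra_simps)
      have "\<theta> \<in> S" using t by (auto simp: S_def \<theta>_def closed_segment_def)
      then show "norm (laplace_kernel \<kappa> j w z) \<le> B * exp (- \<bar>v\<bar>)"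
        using b[of w \<theta> j v] S by (simp add: z u_def B_def)
      show "(Q has_field_derivative laplace_kernel \<kappa> j w z) (at z within closed_segment (u \<theta>\<^sub>1) (u \<theta>\<^sub>2))"
        by (rule has_field_derivative_at_within[OF Q])
    qed auto
    moreover have "norm (u \<theta>\<^sub>2 - u \<theta>\<^sub>1) = \<bar>\<theta>\<^sub>2 - \<theta>\<^sub>1\<bar>"
    proof -
      have "u \<theta>\<^sub>2 - u \<theta>\<^sub>1 = \<i> * of_real (\<theta>\<^sub>2 - \<theta>\<^sub>1)" by (simp add: u_def algebra_simps)
      then show ?thesis by (simp only: norm_mult norm_of_real norm_ii mult_1)
    qed
    ultimately have "norm (q \<theta>\<^sub>2 v - q \<theta>\<^sub>1 v) \<le> B * exp (- \<bar>v\<bar>) * \<bar>\<theta>\<^sub>2 - \<theta>\<^sub>1\<bar>"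
      by (simp add: q_def u_def)
    then show ?thesis by simp
  qed
  have "(\<lambda>n. (q \<theta>\<^sub>2 (real n) - q \<theta>\<^sub>2 (- real n)) - (q \<theta>\<^sub>1 (real n) - q \<theta>\<^sub>1 (- real n))) \<longlonglongrightarrow> 0"
  proof (rule Lim_null_comparison)
    show "\<forall>\<^sub>F n in sequentially. norm ((q \<theta>\<^sub>2 (real n) - q \<theta>\<^sub>2 (- real n)) - (q \<theta>\<^sub>1 (real n) - q \<theta>\<^sub>1 (- real n)))
        \<le> 2 * (B * exp (- real n) * \<bar>\<theta>\<^sub>2 - \<theta>\<^sub>1\<bar>)"
    proof (rule always_eventually, rule allI)
      fix n :: nat
      have "(q \<theta>\<^sub>2 (real n) - q \<theta>\<^sub>2 (- real n)) - (q \<theta>\<^sub>1 (real n) - q \<theta>\<^sub>1 (- real n)) =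
          (q \<theta>\<^sub>2 (real n) - q \<theta>\<^sub>1 (real n)) - (q \<theta>\<^sub>2 (- real n) - q \<theta>\<^sub>1 (- real n))" by simp
      also have "norm \<dots> \<le> norm (q \<theta>\<^sub>2 (real n) - q \<theta>\<^sub>1 (real n)) + norm (q \<theta>\<^sub>2 (- real n) - q \<theta>\<^sub>1 (- real n))"
        by (rule norm_triangle_ineq4)
      also have "\<dots> \<le> B * exp (- real n) * \<bar>\<theta>\<^sub>2 - \<theta>\<^sub>1\<bar> + B * exp (- real n) * \<bar>\<theta>\<^sub>2 - \<theta>\<^sub>1\<bar>"
        using vert[of "real n"] vert[of "- real n"] by (intro add_mono) auto
      finally show "norm ((q \<theta>\<^sub>2 (real n) - q \<theta>\<^sub>2 (- real n)) - (q \<theta>\<^sub>1 (real n) - q \<theta>\<^sub>1 (- real n)))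
        \<le> 2 * (B * exp (- real n) * \<bar>\<theta>\<^sub>2 - \<theta>\<^sub>1\<bar>)" by (simp only: mult_2)
    qed
    have "(\<lambda>n. exp (- real n)) \<longlonglongrightarrow> 0" by real_asymp
    then have "(\<lambda>n. 2 * (B * exp (- real n) * \<bar>\<theta>\<^sub>2 - \<theta>\<^sub>1\<bar>)) \<longlonglongrightarrow> 2 * (B * 0 * \<bar>\<theta>\<^sub>2 - \<theta>\<^sub>1\<bar>)"
      by (intro tendsto_intros)
    then show "(\<lambda>n. 2 * (B * exp (- real n) * \<bar>\<theta>\<^sub>2 - \<theta>\<^sub>1\<bar>)) \<longlonglongrightarrow> 0" by simp
  qed
  moreover have "(\<lambda>n. (q \<theta>\<^sub>2 (real n) - q \<theta>\<^sub>2 (- real n)) - (q \<theta>\<^sub>1 (real n) - q \<theta>\<^sub>1 (- real n)))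
      \<longlonglongrightarrow> (\<integral>v. P \<theta>\<^sub>2 v \<partial>lborel) - (\<integral>v. P \<theta>\<^sub>1 v \<partial>lborel)"
    by (intro tendsto_diff lim 1 2)
  ultimately have "(\<integral>v. P \<theta>\<^sub>2 v \<partial>lborel) - (\<integral>v. P \<theta>\<^sub>1 v \<partial>lborel) = 0"
    by (rule LIMSEQ_unique[rotated])
  then show ?thesis by (simp add: P_def)
qed

section \<open>Completely monotone functions on sectors\<close>

text \<open>The line of integration is turned with \<open>w\<close> so that \<open>Im (w + u) = Im w / \<alpha>\<close> stays
  in \<open>(-\<pi>/2, \<pi>/2)\<close> on the whole sector.\<close>

definition kernel_angle :: "real \<Rightarrow> complex \<Rightarrow> real" where
  "kernel_angle \<alpha> w = - ((\<alpha> - 1) / \<alpha> * Im w)"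

definition kernel_integral :: "real \<Rightarrow> real \<Rightarrow> nat \<Rightarrow> complex \<Rightarrow> complex" where
  "kernel_integral \<kappa> \<alpha> j w =
     (\<integral>v. laplace_kernel \<kappa> j w (of_real v + \<i> * of_real (kernel_angle \<alpha> w)) \<partial>lborel)"

lemma kernel_angle_bounds:
  assumes "\<alpha> > 1" "w \<in> sector \<alpha>"
  shows "\<bar>kernel_angle \<alpha> w\<bar> \<le> (\<alpha> - 1) * pi / 2" "\<bar>Im w + kernel_angle \<alpha> w\<bar> < pi / 2"
proof -
  have w: "\<bar>Im w\<bar> < \<alpha> * pi / 2" using assms by (simp add: sector_iff)
  have "\<bar>kernel_angle \<alpha> w\<bar> = (\<alpha> - 1) / \<alpha> * \<bar>Im w\<bar>"
    using assms(1) by (simp add: kernel_angle_def abs_mult)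
  also have "\<dots> \<le> (\<alpha> - 1) / \<alpha> * (\<alpha> * pi / 2)"
    using w assms(1) by (intro mult_left_mono) auto
  finally show "\<bar>kernel_angle \<alpha> w\<bar> \<le> (\<alpha> - 1) * pi / 2" using assms(1) by simp
  have "Im w + kernel_angle \<alpha> w = Im w / \<alpha>"
    using assms(1) by (simp add: kernel_angle_def field_simps)
  moreover have "\<bar>Im w / \<alpha>\<bar> = \<bar>Im w\<bar> / \<alpha>" using assms(1) by simp
  moreover have "\<bar>Im w\<bar> / \<alpha> < pi / 2" using w assms(1) by (simp add: field_simps)
  ultimately show "\<bar>Im w + kernel_angle \<alpha> w\<bar> < pi / 2" by (simp only:)
qed

text \<open>The ray turns with \<open>w\<close> in a non-holomorphic way, so the defining integral
  is not differentiated directly. The angle is frozen at its value for \<open>w0\<close>, the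
  integral over the fixed ray is differentiated in z = exp w, and the contour shift identifies it
  with \<open>kernel_integral\<close> near \<open>w0\<close>.\<close>

lemma kernel_integral_deriv:
  assumes \<alpha>: "\<alpha> > 1" and \<kappa>: "\<kappa> > 0" "\<kappa> * (\<alpha> - 1) < 1" and w0: "w0 \<in> sector \<alpha>"
  shows "(kernel_integral \<kappa> \<alpha> j has_field_derivative - exp w0 * kernel_integral \<kappa> \<alpha> (Suc j) w0) (at w0)"
proof -
  \<comment> \<open>The strict inequality keeps the damping positive even at the extreme value
    (\<alpha> - 1) pi / 2 of \<open>kernel_angle\<close>.\<close>
  have \<kappa>': "\<kappa> * ((\<alpha> - 1) * pi / 2) < pi / 2"
    using mult_strict_right_mono[OF \<kappa>(2), of "pi / 2"] by (simp add: mult_ac)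
  define \<theta> where "\<theta> = kernel_angle \<alpha> w0"
  have \<theta>: "\<bar>\<theta>\<bar> \<le> (\<alpha> - 1) * pi / 2" "\<bar>Im w0 + \<theta>\<bar> < pi / 2"
    unfolding \<theta>_def by (rule kernel_angle_bounds[OF \<alpha> w0])+
  define s where "s = (\<lambda>v. exp (of_real v + \<i> * complex_of_real \<theta>))"
  define g where "g = (\<lambda>j v. exp (of_nat (Suc j) * (of_real v + \<i> * of_real \<theta>)
             - exp (of_real \<kappa> * (of_real v + \<i> * complex_of_real \<theta>))))"
  define \<Phi> where "\<Phi> = (\<lambda>j z. \<integral>v. exp (- (z * s v)) * g j v \<partial>lborel)"
  have g: "integrable lborel (g j)" for j
    unfolding g_def by (rule damping_integrable[OF \<kappa>(1) \<kappa>' \<theta>(1)])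
  have sg: "s v * g j v = g (Suc j) v" for v j
    by (simp add: s_def g_def algebra_simps flip: exp_add)
  have kern: "exp (- (exp w * s v)) * g j v = laplace_kernel \<kappa> j w (of_real v + \<i> * of_real \<theta>)" for w j v
    by (simp add: s_def g_def laplace_kernel_def algebra_simps flip: exp_add)
  define H where "H = {z. Re (z * exp (\<i> * of_real \<theta>)) > 0}"
  have "open H" unfolding H_def by (intro open_Collect_less continuous_intros)
  moreover have "exp w0 \<in> H"
  proof -
    have "cos (Im w0 + \<theta>) > 0" using \<theta>(2) by (intro cos_gt_zero_pi) linarith+
    moreover have "Re (exp w0 * exp (\<i> * of_real \<theta>)) = exp (Re w0) * cos (Im w0 + \<theta>)"
      unfolding exp_add[symmetric] Re_exp by simp
    ultimately show ?thesis by (simp add: H_def del: times_complex.sel)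
  qed
  moreover have "Re (z * s v) \<ge> 0" if "z \<in> H" for z v
  proof -
    have "z * s v = of_real (exp v) * (z * exp (\<i> * of_real \<theta>))"
      by (simp add: s_def exp_add mult_ac flip: exp_of_real)
    then have "Re (z * s v) = exp v * Re (z * exp (\<i> * of_real \<theta>))"
      by (simp only: Re_complex_of_real Im_complex_of_real times_complex.sel mult_zero_left diff_zero)
    then show ?thesis using that unfolding H_def by simp
  qed
  moreover have "s \<in> borel_measurable lborel"
    unfolding s_def by (intro continuous_imp_borel_measurable_lborel continuous_intros)
  ultimately have "(\<Phi> j has_field_derivative - (\<integral>v. exp (- (exp w0 * s v)) * (s v * g j v) \<partial>lborel)) (at (exp w0))"
    unfolding \<Phi>_def using g by (intro has_field_derivative_laplace[where H = H]) (simp_all add: sg)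
  then have "(\<Phi> j has_field_derivative - \<Phi> (Suc j) (exp w0)) (at (exp w0))"
    by (simp add: sg \<Phi>_def)
  from DERIV_chain2[OF this DERIV_exp]
  have D: "((\<lambda>w. \<Phi> j (exp w)) has_field_derivative - \<Phi> (Suc j) (exp w0) * exp w0) (at w0)" .
  define T where "T = sector \<alpha> \<inter> {w. \<bar>Im w + \<theta>\<bar> < pi / 2}"
  have T: "open T"
    unfolding T_def by (intro open_Int open_sector open_Collect_less continuous_intros)
  have w0T: "w0 \<in> T" using w0 \<theta>(2) by (simp add: T_def)
  have eq: "\<Phi> j (exp w) = kernel_integral \<kappa> \<alpha> j w" if "w \<in> T" for w j
  proof -
    have w: "w \<in> sector \<alpha>" "\<bar>Im w + \<theta>\<bar> \<le> pi / 2" using that by (auto simp: T_def)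
    show ?thesis
      unfolding \<Phi>_def kern kernel_integral_def
      using kernel_angle_bounds[OF \<alpha> w(1)] w(2) \<theta>(1)
      by (intro kernel_integral_shift[OF \<kappa>(1) \<kappa>']) auto
  qed
  have "(kernel_integral \<kappa> \<alpha> j has_field_derivative - \<Phi> (Suc j) (exp w0) * exp w0) (at w0)"
    by (rule has_field_derivative_transform_within_open[OF D T w0T]) (rule eq)
  then show ?thesis by (simp add: eq[OF w0T] mult.commute)
qed

lemma kernel_integral_bound:
  assumes \<alpha>: "\<alpha> > 1" and \<kappa>: "\<kappa> > 0" "\<kappa> * (\<alpha> - 1) < 1"
  obtains C h where "C > 0" "h > 0"
    "\<And>j w. w \<in> sector \<alpha> \<Longrightarrow> norm (kernel_integral \<kappa> \<alpha> j w) \<le> C * h ^ j * gevrey_seq (1 / \<kappa>) j"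
proof -
  have \<kappa>': "\<kappa> * ((\<alpha> - 1) * pi / 2) < pi / 2"
    using mult_strict_right_mono[OF \<kappa>(2), of "pi / 2"] by (simp add: mult_ac)
  have \<theta>0: "(\<alpha> - 1) * pi / 2 \<ge> 0" using \<alpha> by simp
  obtain C h where C: "C > 0" and h: "h > 0"
    and b: "\<And>j w \<theta> v. \<bar>Im w + \<theta>\<bar> \<le> pi / 2 \<Longrightarrow> \<bar>\<theta>\<bar> \<le> (\<alpha> - 1) * pi / 2 \<Longrightarrow>
       norm (laplace_kernel \<kappa> j w (of_real v + \<i> * of_real \<theta>))
         \<le> C * h ^ j * gevrey_seq (1 / \<kappa>) j * exp (- \<bar>v\<bar>)"
    using kernel_uniform_bound[OF \<kappa>(1) \<theta>0 \<kappa>'] by metis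
  define I where "(I :: real) = (\<integral>v. exp (- \<bar>v\<bar>) \<partial>lborel)"
  have I: "I \<ge> 0" unfolding I_def by (intro Bochner_Integration.integral_nonneg) auto
  have "norm (kernel_integral \<kappa> \<alpha> j w) \<le> (C * (I + 1)) * h ^ j * gevrey_seq (1 / \<kappa>) j"
    if w: "w \<in> sector \<alpha>" for j w
  proof -
    note a = kernel_angle_bounds[OF \<alpha> w]
    have "norm (kernel_integral \<kappa> \<alpha> j w)
        \<le> (\<integral>v. C * h ^ j * gevrey_seq (1 / \<kappa>) j * exp (- \<bar>v\<bar>) \<partial>lborel)"
      unfolding kernel_integral_def
      by (intro Bochner_Integration.integral_norm_bound_integral integrable_mult_right integrable_exp_minus_abs b
          kernel_integrable[OF \<kappa>(1) \<kappa>' _ a(1)] a(1)) (use a(2) in auto)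
    also have "\<dots> = C * h ^ j * gevrey_seq (1 / \<kappa>) j * I" by (simp add: I_def)
    also have "\<dots> \<le> C * h ^ j * gevrey_seq (1 / \<kappa>) j * (I + 1)"
      using C h gevrey_seq_pos[of "1 / \<kappa>" j] by (intro mult_left_mono) auto
    finally show ?thesis by (simp add: mult_ac)
  qed
  then show thesis using that[of "C * (I + 1)" h] C h I by simp
qed

text \<open>At real points the angle is 0 and the integrand is positive: this is the source of
  complete monotonicity.\<close>

lemma kernel_integral_of_real:
  "kernel_integral \<kappa> \<alpha> j (of_real x) =
     of_real (\<integral>v. exp (real (Suc j) * v - exp (x + v) - exp (\<kappa> * v)) \<partial>lborel)"
proof -
  have "laplace_kernel \<kappa> j (of_real x) (of_real v) =
      of_real (exp (real (Suc j) * v - exp (x + v) - exp (\<kappa> * v)))" for v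
    by (simp add: laplace_kernel_def flip: exp_of_real)
  then show ?thesis
    by (simp add: kernel_integral_def kernel_angle_def flip: integral_complex_of_real)
qed

text \<open>Up to a constant factor in s, the peak of s^j exp (- s^\<kappa>) is at s = j powr (1 /
  \<kappa>), that is at v = \<open>a\<close>. The window from \<open>a\<close> to
  \<open>a + 1\<close> already gives the claimed size, and x = - a keeps exp (x + v) below exp 1
  there. The constant \<open>c\<close> collects the loss per order from both damping terms.\<close>

lemma kernel_integral_lower_bound:
  fixes \<kappa> :: real
  assumes \<kappa>: "\<kappa> > 0"
  obtains c where "c > 0" "\<And>j. j \<ge> 1 \<Longrightarrow>
    \<exists>x. c ^ j * gevrey_seq (1 / \<kappa>) j \<le> (\<integral>v. exp (real (Suc j) * v - exp (x + v) - exp (\<kappa> * v)) \<partial>lborel)"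
proof -
  define c where "c = exp (- (exp 1 + exp \<kappa>))"
  have "\<exists>x. c ^ j * gevrey_seq (1 / \<kappa>) j \<le> (\<integral>v. exp (real (Suc j) * v - exp (x + v) - exp (\<kappa> * v)) \<partial>lborel)"
    if j: "j \<ge> 1" for j
  proof
    define a where "a = ln (real j) / \<kappa>"
    have a: "a \<ge> 0" using j \<kappa> by (simp add: a_def)
    define K where "K = c ^ j * gevrey_seq (1 / \<kappa>) j"
    have K: "K = exp (real j * a - real j * (exp 1 + exp \<kappa>))"
      using j by (simp add: K_def c_def gevrey_seq_def powr_def a_def exp_diff exp_minus
          exp_add field_simps flip: exp_of_nat_mult)
    have "K = (\<integral>v. indicator {a..a + 1} v * K \<partial>lborel)" by simp
    also have "\<dots> \<le> (\<integral>v. exp (real (Suc j) * v - exp (- a + v) - exp (\<kappa> * v)) \<partial>lborel)"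
    proof (rule integral_mono)
      show "integrable lborel (\<lambda>v. indicator {a..a + 1} v * K)" by simp
      show "integrable lborel (\<lambda>v. exp (real (Suc j) * v - exp (- a + v) - exp (\<kappa> * v)))"
      proof (rule Bochner_Integration.integrable_bound)
        show "integrable lborel (\<lambda>v. exp (real (Suc j) * v - 1 * exp (\<kappa> * v)))"
          by (rule integrable_exp_linear_minus_exp[OF \<kappa>]) simp
      qed auto
      show "indicator {a..a + 1} v * K \<le> exp (real (Suc j) * v - exp (- a + v) - exp (\<kappa> * v))" for v
      proof (cases "v \<in> {a..a + 1}")
        case True
        then have v: "a \<le> v" "v \<le> a + 1" by auto
        have "real j * a \<le> real (Suc j) * v" using v a by (intro mult_mono) auto
        moreover have "exp (- a + v) \<le> real j * exp 1"
        proof -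
          have "exp (- a + v) \<le> exp 1" using v by simp
          also have "\<dots> \<le> real j * exp 1" using j by simp
          finally show ?thesis .
        qed
        moreover have "exp (\<kappa> * v) \<le> real j * exp \<kappa>"
        proof -
          have "\<kappa> * v \<le> \<kappa> * (a + 1)" using v \<kappa> by (intro mult_left_mono) auto
          then have "exp (\<kappa> * v) \<le> exp (\<kappa> * (a + 1))" by simp
          also have "\<kappa> * (a + 1) = ln (real j) + \<kappa>" using \<kappa> by (simp add: a_def field_simps)
          also have "exp (ln (real j) + \<kappa>) = real j * exp \<kappa>" using j by (simp add: exp_add)
          finally show ?thesis .
        qed
        ultimately have "real j * a - real j * (exp 1 + exp \<kappa>)
            \<le> real (Suc j) * v - exp (- a + v) - exp (\<kappa> * v)"
          unfolding distrib_left by linarith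
        then show ?thesis using True by (simp add: K)
      qed simp
    qed
    finally show "c ^ j * gevrey_seq (1 / \<kappa>) j
        \<le> (\<integral>v. exp (real (Suc j) * v - exp (- a + v) - exp (\<kappa> * v)) \<partial>lborel)"
      by (simp add: K_def)
  qed
  then show thesis using that[of c] by (simp add: c_def)
qed

section \<open>Superposition of dilates with log-convex weights\<close>

text \<open>The quotients of consecutive terms increase, so the geometric sequence through
  \<open>L k\<close> with ratio \<open>L (Suc k) / L k\<close> stays below \<open>L\<close>. It is a
  tangent line of the convex function ln L, written without negative powers.\<close>

lemma log_convex_tangent:
  assumes L: "log_convex_seq L"
  shows "L k * (L (Suc k) / L k) ^ j \<le> L j * (L (Suc k) / L k) ^ k"
proof -
  define r where "r = (\<lambda>k. L (Suc k) / L k)"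
  have pos: "L j > 0" for j by (rule log_convex_seq_pos[OF L])
  then have r_pos: "r k > 0" for k by (simp add: r_def)
  have "r k \<le> r (Suc k)" for k
    using log_convex_seq_Suc[OF L, of k] pos[of k] pos[of "Suc k"]
    by (simp add: r_def power2_eq_square field_simps)
  then have mono: "r i \<le> r k" if "i \<le> k" for i k
    using that by (rule lift_Suc_mono_le)
  have step: "L (Suc i) = r i * L i" for i using pos[of i] by (simp add: r_def)
  have "L k * r k ^ j \<le> L j * r k ^ k"
  proof (cases "k \<le> j")
    case True
    then show ?thesis
    proof (induction j rule: dec_induct)
      case (step i)
      have "L k * r k ^ Suc i = r k * (L k * r k ^ i)" by simp
      also have "\<dots> \<le> r k * (L i * r k ^ k)"
        using step.IH r_pos[of k] by (intro mult_left_mono) auto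
      also have "\<dots> \<le> r i * (L i * r k ^ k)"
        using mono[of k i] step.hyps r_pos[of k] pos[of i] by (intro mult_right_mono) auto
      also have "\<dots> = L (Suc i) * r k ^ k" using pos[of i] by (simp add: r_def)
      finally show ?case .
    qed simp
  next
    case False
    then have "j \<le> k" by simp
    then show ?thesis
    proof (induction j rule: inc_induct)
      case (step i)
      have "r k * (L k * r k ^ i) = L k * r k ^ Suc i" by simp
      also have "\<dots> \<le> L (Suc i) * r k ^ k" by (rule step.IH)
      also have "\<dots> = r i * (L i * r k ^ k)" using pos[of i] by (simp add: r_def)
      also have "\<dots> \<le> r k * (L i * r k ^ k)"
        using mono[of i k] step.hyps r_pos[of k] pos[of i] by (intro mult_right_mono) auto
      finally show ?case using r_pos[of k] by simp
    qed simp
  qed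
  then show ?thesis by (simp add: r_def)
qed

lemma sector_add_of_real: "w \<in> sector \<alpha> \<Longrightarrow> w + of_real t \<in> sector \<alpha>"
  by (simp add: sector_def)

text \<open>Superposing dilates of \<open>E\<close> with weights \<open>2^-k L k / r k^k\<close>, where \<open>r k = L (k + 1) / L k\<close>,
  multiplies the size of the \<open>j\<close>-th derivative by \<open>L j\<close>: log-convexity makes the \<open>j\<close>-th term
  of the derived series the dominant one.\<close>

lemma log_convex_superposition:
  fixes E :: "nat \<Rightarrow> complex \<Rightarrow> complex" and e :: "nat \<Rightarrow> real \<Rightarrow> real"
  assumes L: "log_convex_seq L" and \<alpha>: "\<alpha> > 0"
    and deriv: "\<And>j w. w \<in> sector \<alpha> \<Longrightarrow> (E j has_field_derivative - exp w * E (Suc j) w) (at w)"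
    and bound: "\<And>j w. w \<in> sector \<alpha> \<Longrightarrow> norm (E j w) \<le> b j"
    and real: "\<And>j x. E j (of_real x) = of_real (e j x)" "\<And>j x. e j x \<ge> 0"
  obtains F f where
    "\<And>j w. w \<in> sector \<alpha> \<Longrightarrow> (F j has_field_derivative - exp w * F (Suc j) w) (at w)"
    "\<And>j w. w \<in> sector \<alpha> \<Longrightarrow> norm (F j w) \<le> 2 * L j * b j"
    "\<And>j x. F j (of_real x) = of_real (f j x)" "\<And>j x. f j x \<ge> 0"
    "\<And>j x. \<exists>y. f j y \<ge> (1 / 2) ^ j * L j * e j x"
proof -
  define r where "r = (\<lambda>k. L (Suc k) / L k)"
  define a where "a = (\<lambda>k j. (1 / 2) ^ k * L k * r k ^ j / r k ^ k)"
  \<comment> \<open>In the logarithmic chart a dilation by \<open>r k\<close> is a translation by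
    \<open>ln (r k)\<close>. Each derivative of the dilate brings out one factor \<open>r k\<close>,
    which \<open>a k j\<close> records.\<close>
  define t where "t = (\<lambda>j k w. of_real (a k j) * E j (w + of_real (ln (r k))))"
  define F where "F = (\<lambda>j w. \<Sum>k. t j k w)"
  define f where "f = (\<lambda>j x. \<Sum>k. a k j * e j (x + ln (r k)))"
  have Lpos: "L j > 0" for j by (rule log_convex_seq_pos[OF L])
  have r: "r k > 0" for k by (simp add: r_def Lpos)
  have a_pos: "a k j > 0" for k j using Lpos r by (simp add: a_def)
  have a_le: "a k j \<le> (1 / 2) ^ k * L j" for k j
  proof -
    have "L k * r k ^ j / r k ^ k \<le> L j"
      using log_convex_tangent[OF L, of k j] r[of k] by (simp add: r_def pos_divide_le_eq)
    from mult_left_mono[OF this, of "(1 / 2) ^ k"] show ?thesis by (simp add: a_def)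
  qed
  have a_Suc: "a k (Suc j) = a k j * r k" for k j by (simp add: a_def)
  have a_diag: "a j j = (1 / 2) ^ j * L j" for j using r[of j] by (simp add: a_def)
  have t_le: "norm (t j k w) \<le> (1 / 2) ^ k * (L j * b j)" if "w \<in> sector \<alpha>" for j k w
  proof -
    have "norm (t j k w) = a k j * norm (E j (w + of_real (ln (r k))))"
      using a_pos[of k j] by (simp add: t_def norm_mult)
    also have "\<dots> \<le> ((1 / 2) ^ k * L j) * b j"
      using a_le[of k j] Lpos[of j] bound[OF sector_add_of_real[OF that]] by (intro mult_mono) auto
    finally show ?thesis by simp
  qed
  have half: "summable (\<lambda>k. (1 / 2 :: real) ^ k * X)" for X
    by (intro summable_mult2 summable_geometric) simp
  have t_sum: "summable (\<lambda>k. norm (t j k w))" if "w \<in> sector \<alpha>" for j w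
    by (rule summable_comparison_test'[OF half[of "L j * b j"]]) (use t_le[OF that] in simp)
  have t_deriv: "(t j k has_field_derivative - exp w * t (Suc j) k w) (at w)"
    if "w \<in> sector \<alpha>" for j k w
  proof -
    have "((\<lambda>w. E j (w + of_real (ln (r k)))) has_field_derivative
        - exp (w + of_real (ln (r k))) * E (Suc j) (w + of_real (ln (r k))) * 1) (at w)"
      by (rule DERIV_chain2[where f = "E j" and g = "\<lambda>w. w + of_real (ln (r k))",
            OF deriv[OF sector_add_of_real[OF that]]]) (auto intro!: derivative_eq_intros)
    then have "(t j k has_field_derivative of_real (a k j) *
        (- exp (w + of_real (ln (r k))) * E (Suc j) (w + of_real (ln (r k))))) (at w)"
      unfolding t_def by (intro DERIV_cmult) simp
    moreover have "exp (of_real (ln (r k))) = complex_of_real (r k)"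
      using r[of k] by (simp add: exp_of_real)
    ultimately show ?thesis by (simp add: t_def a_Suc exp_add mult_ac)
  qed
  show thesis
  proof
    fix j w assume w: "w \<in> sector \<alpha>"
    show "norm (F j w) \<le> 2 * L j * b j"
    proof -
      have "norm (F j w) \<le> (\<Sum>k. norm (t j k w))"
        unfolding F_def by (rule summable_norm[OF t_sum[OF w]])
      also have "\<dots> \<le> (\<Sum>k. (1 / 2) ^ k * (L j * b j))"
        by (intro suminf_le t_le w t_sum half)
      also have "\<dots> = 2 * L j * b j"
        by (subst suminf_mult2[symmetric]) (auto simp: suminf_geometric)
      finally show ?thesis .
    qed
    obtain d where d: "d > 0" "ball w d \<subseteq> sector \<alpha>"
      using open_sector w by (meson open_contains_ball)
    have "((\<lambda>w. \<Sum>k. t j k w) has_field_derivative (\<Sum>k. - exp w * t (Suc j) k w)) (at w)"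
    proof (rule has_field_derivative_series'(2))
      show "convex (ball w d)" by simp
      show "w \<in> ball w d" "w \<in> interior (ball w d)" using d by auto
      show "(t j k has_field_derivative - exp z * t (Suc j) k z) (at z within ball w d)"
        if "z \<in> ball w d" for k z
        using t_deriv d that by (blast intro: has_field_derivative_at_within)
      show "summable (\<lambda>k. t j k w)" using t_sum[OF w] by (rule summable_norm_cancel)
      show "uniformly_convergent_on (ball w d) (\<lambda>n z. \<Sum>k<n. - exp z * t (Suc j) k z)"
      proof (rule Weierstrass_m_test')
        show "summable (\<lambda>k. (1 / 2) ^ k * (exp (Re w + d) * (L (Suc j) * b (Suc j))))"
          by (rule half)
        fix k z assume z: "z \<in> ball w d"
        have "\<bar>Re (z - w)\<bar> < d"
          using z abs_Re_le_cmod[of "z - w"] by (simp add: dist_norm norm_minus_commute)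
        then have "norm (- exp z) \<le> exp (Re w + d)" by simp
        moreover have "norm (t (Suc j) k z) \<le> (1 / 2) ^ k * (L (Suc j) * b (Suc j))"
          using z d by (intro t_le) auto
        ultimately have "norm (- exp z) * norm (t (Suc j) k z)
            \<le> exp (Re w + d) * ((1 / 2) ^ k * (L (Suc j) * b (Suc j)))"
          by (intro mult_mono) auto
        then show "norm (- exp z * t (Suc j) k z)
            \<le> (1 / 2) ^ k * (exp (Re w + d) * (L (Suc j) * b (Suc j)))"
          by (simp add: norm_mult mult_ac)
      qed
    qed
    then show "(F j has_field_derivative - exp w * F (Suc j) w) (at w)"
      unfolding F_def using suminf_mult[OF summable_norm_cancel[OF t_sum[OF w, of "Suc j"]], of "- exp w"]
      by simp
  next
    fix j x
    have t_real: "t j k (of_real x) = of_real (a k j * e j (x + ln (r k)))" for k j x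
      by (simp add: t_def flip: of_real_add real(1))
    have sum: "summable (\<lambda>k. a k j * e j (x + ln (r k)))" for j x
    proof -
      have "norm (t j k (of_real x)) = a k j * e j (x + ln (r k))" for k
        unfolding t_real using a_pos[of k j] real(2) by (simp add: norm_mult)
      then show ?thesis using t_sum[OF of_real_in_sector[OF \<alpha>], of j x] by simp
    qed
    show "F j (of_real x) = of_real (f j x)"
      unfolding F_def f_def t_real by (rule suminf_of_real[OF sum, symmetric])
    show "f j x \<ge> 0"
      unfolding f_def using a_pos real(2) by (intro suminf_nonneg sum) (simp add: less_imp_le)
    show "\<exists>y. f j y \<ge> (1 / 2) ^ j * L j * e j x"
    proof
      \<comment> \<open>The shift undoes the j-th dilation, and nonnegativity lets the single term k
        = j bound the series from below.\<close>
      define y where "y = x - ln (r j)"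
      have "(\<Sum>k\<in>{j}. a k j * e j (y + ln (r k))) \<le> f j y"
        unfolding f_def using a_pos real(2) by (intro sum_le_suminf sum) (simp_all add: less_imp_le)
      then show "(1 / 2) ^ j * L j * e j x \<le> f j y" by (simp add: y_def a_diag)
    qed
  qed
qed

text \<open>With \<kappa> = 1 / \<gamma> the condition \<gamma> > \<alpha> - 1 reads \<kappa>
  (\<alpha> - 1) < 1. The kernel contributes \<open>gevrey_seq \<gamma>\<close>, the superposition
  contributes \<open>L\<close>. Upper and lower bounds agree up to geometric factors, and the point
  in the lower bound may change with \<open>j\<close>.\<close>

lemma completely_monotone_function:
  assumes \<alpha>: "\<alpha> > 1" and \<gamma>: "\<gamma> > \<alpha> - 1" and L: "log_convex_seq L"
  obtains f a A h c where "f holomorphic_on sector \<alpha>" "A > 0" "h > 0" "c > 0"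
    "\<And>j w. w \<in> sector \<alpha> \<Longrightarrow> norm ((zderiv ^^ j) f w) \<le> A * h ^ j * (gevrey_seq \<gamma> j * L j)"
    "\<And>j x. (zderiv ^^ j) f (of_real x) = of_real ((- 1) ^ j * a j x)" "\<And>j x. a j x \<ge> 0"
    "\<And>j. j \<ge> 1 \<Longrightarrow> \<exists>x. a j x \<ge> c ^ j * (gevrey_seq \<gamma> j * L j)"
proof -
  define \<kappa> where "\<kappa> = 1 / \<gamma>"
  have \<gamma>0: "\<gamma> > 0" using \<alpha> \<gamma> by simp
  have \<kappa>: "\<kappa> > 0" "\<kappa> * (\<alpha> - 1) < 1" "1 / \<kappa> = \<gamma>"
    using \<gamma>0 \<gamma> by (auto simp: \<kappa>_def)
  have \<alpha>0: "\<alpha> > 0" using \<alpha> by simp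
  define e where "e = (\<lambda>j x. \<integral>v. exp (real (Suc j) * v - exp (x + v) - exp (\<kappa> * v)) \<partial>lborel)"
  obtain C h where C: "C > 0" and h: "h > 0"
    and Cb: "\<And>j w. w \<in> sector \<alpha> \<Longrightarrow> norm (kernel_integral \<kappa> \<alpha> j w) \<le> C * h ^ j * gevrey_seq \<gamma> j"
    using kernel_integral_bound[OF \<alpha> \<kappa>(1,2)] unfolding \<kappa>(3) by metis
  have e0: "e j x \<ge> 0" for j x
    unfolding e_def by (intro Bochner_Integration.integral_nonneg) auto
  have e_real: "kernel_integral \<kappa> \<alpha> j (of_real x) = of_real (e j x)" for j x
    unfolding e_def by (rule kernel_integral_of_real)
  obtain F a where
    Fd: "\<And>j w. w \<in> sector \<alpha> \<Longrightarrow> (F j has_field_derivative - exp w * F (Suc j) w) (at w)" and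
    Fb: "\<And>j w. w \<in> sector \<alpha> \<Longrightarrow> norm (F j w) \<le> 2 * L j * (C * h ^ j * gevrey_seq \<gamma> j)" and
    Fr: "\<And>j x. F j (of_real x) = of_real (a j x)" and a0: "\<And>j x. a j x \<ge> 0" and
    al: "\<And>j x. \<exists>y. a j y \<ge> (1 / 2) ^ j * L j * e j x"
    using log_convex_superposition[where E = "kernel_integral \<kappa> \<alpha>" and e = e
        and b = "\<lambda>j. C * h ^ j * gevrey_seq \<gamma> j", OF L \<alpha>0 kernel_integral_deriv[OF \<alpha> \<kappa>(1,2)] Cb e_real e0]
    by metis
  have z: "(zderiv ^^ j) (F 0) w = (- 1) ^ j * F j w" if "w \<in> sector \<alpha>" for j w
  proof (rule zderiv_funpow_eqI[OF open_sector, where F = "\<lambda>j w. (- 1) ^ j * F j w"])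
    show "((\<lambda>w. (- 1) ^ n * F n w) has_field_derivative exp w * ((- 1) ^ Suc n * F (Suc n) w)) (at w)"
      if "w \<in> sector \<alpha>" for n w
      using DERIV_cmult[OF Fd[OF that, of n], of "(- 1) ^ n"] by (simp add: mult_ac)
  qed (use that in auto)
  obtain c where c: "c > 0" and cl: "\<And>j. j \<ge> 1 \<Longrightarrow> \<exists>x. c ^ j * gevrey_seq \<gamma> j \<le> e j x"
    using kernel_integral_lower_bound[OF \<kappa>(1)] unfolding \<kappa>(3) e_def by metis
  show thesis
  proof
    show "F 0 holomorphic_on sector \<alpha>"
      using Fd[of _ 0] by (meson field_differentiable_at_within field_differentiable_def holomorphic_on_def)
    show "2 * C > 0" "h > 0" "c / 2 > 0" using C h c by auto
    show "norm ((zderiv ^^ j) (F 0) w) \<le> (2 * C) * h ^ j * (gevrey_seq \<gamma> j * L j)"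
      if "w \<in> sector \<alpha>" for j w
      using Fb[OF that, of j] by (simp add: z[OF that] norm_mult norm_power mult_ac)
    show "(zderiv ^^ j) (F 0) (of_real x) = of_real ((- 1) ^ j * a j x)" for j x
      by (simp add: z[OF of_real_in_sector[OF \<alpha>0]] Fr)
    show "a j x \<ge> 0" for j x by (rule a0)
    show "\<exists>x. a j x \<ge> (c / 2) ^ j * (gevrey_seq \<gamma> j * L j)" if j: "j \<ge> 1" for j
    proof -
      obtain x where x: "c ^ j * gevrey_seq \<gamma> j \<le> e j x" using cl[OF j] by blast
      obtain y where y: "a j y \<ge> (1 / 2) ^ j * L j * e j x" using al by blast
      have "(c / 2) ^ j * (gevrey_seq \<gamma> j * L j) = (1 / 2) ^ j * L j * (c ^ j * gevrey_seq \<gamma> j)"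
        by (simp add: power_divide)
      also have "\<dots> \<le> (1 / 2) ^ j * L j * e j x"
        using x log_convex_seq_pos[OF L, of j] by (intro mult_left_mono) auto
      finally show ?thesis using y by (intro exI[of _ y]) linarith
    qed
  qed
qed

section \<open>Reciprocals of completely monotone functions\<close>

lemma jet_const_on:
  assumes "open S" "\<And>w. w \<in> S \<Longrightarrow> f w = c" "w \<in> S"
  shows "jet f w = fps_const c"
proof (rule fps_ext)
  fix n
  have "(zderiv ^^ n) f w = (if n = 0 then c else 0)"
    by (rule zderiv_funpow_eqI[OF assms(1), where F = "\<lambda>n w. if n = 0 then c else 0"])
       (use assms in auto)
  then show "jet f w $ n = fps_const c $ n" by (simp add: jet_nth)
qed

text \<open>Reciprocals of \<open>D - (a\<^sub>1 x + a\<^sub>2 x\<^sup>2 + \<dots>)\<close> with \<open>a\<^sub>j \<ge> 0\<close> have nonnegative coefficients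
  satisfying \<open>D r\<^sub>k = \<Sum> a\<^sub>j r\<^sub>k\<^sub>-\<^sub>j\<close>; the signs \<open>(- 1)^j\<close> account for expanding in \<open>- x\<close>.\<close>

lemma reciprocal_coeff_lower_bound:
  fixes G R :: "complex fps" and a :: "nat \<Rightarrow> real"
  assumes GR: "G * R = 1" and D: "D > 0" and G0: "G $ 0 = of_real D"
    and G: "\<And>j. j \<ge> 1 \<Longrightarrow> G $ j = - of_real ((- 1) ^ j * a j)" and a: "\<And>j. a j \<ge> 0"
    and j: "j \<ge> 1"
  shows "(a j / D) ^ l / D \<le> norm (R $ (j * l))"
proof -
  define r where "r = (\<lambda>k. Re ((- 1) ^ k * R $ k))"
  have r0: "r 0 = 1 / D"
  proof -
    have "G $ 0 * R $ 0 = 1" using arg_cong[OF GR, of "\<lambda>F. fps_nth F 0"] by simp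
    then have "R $ 0 = of_real (1 / D)" using D by (simp add: G0 field_simps)
    then show ?thesis by (simp add: r_def)
  qed
  have rec: "D * r k = (\<Sum>j=1..k. a j * r (k - j))" if k: "k \<ge> 1" for k
  proof -
    have "0 = (G * R) $ k" using k by (simp add: GR)
    also have "\<dots> = (\<Sum>j=0..k. G $ j * R $ (k - j))" by (simp add: fps_mult_nth)
    also have "\<dots> = G $ 0 * R $ k + (\<Sum>j=1..k. G $ j * R $ (k - j))"
      by (simp add: sum.atLeast_Suc_atMost)
    also have "(\<Sum>j=1..k. G $ j * R $ (k - j)) = - (\<Sum>j=1..k. of_real ((- 1) ^ j * a j) * R $ (k - j))"
      by (simp add: G sum_negf)
    finally have "of_real D * R $ k = (\<Sum>j=1..k. of_real ((- 1) ^ j * a j) * R $ (k - j))"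
      by (simp add: G0)
    then have "(- 1) ^ k * (of_real D * R $ k)
        = (\<Sum>j=1..k. (- 1) ^ k * (of_real ((- 1) ^ j * a j) * R $ (k - j)))"
      by (simp only: sum_distrib_left)
    also have "\<dots> = (\<Sum>j=1..k. of_real (a j) * ((- 1) ^ (k - j) * R $ (k - j)))"
    proof (rule sum.cong)
      fix j assume "j \<in> {1..k}"
      then have "(- 1 :: complex) ^ k = (- 1) ^ j * (- 1) ^ (k - j)" by (simp flip: power_add)
      then have "(- 1 :: complex) ^ k * (- 1) ^ j = ((- 1) ^ j * (- 1) ^ j) * (- 1) ^ (k - j)"
        by simp
      also have "(- 1 :: complex) ^ j * (- 1) ^ j = 1" by (simp flip: power_mult_distrib)
      finally have s: "(- 1 :: complex) ^ k * (- 1) ^ j = (- 1) ^ (k - j)" by simp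
      have "(- 1) ^ k * (of_real ((- 1) ^ j * a j) * R $ (k - j))
          = ((- 1) ^ k * (- 1) ^ j) * (of_real (a j) * R $ (k - j))" by simp
      then show "(- 1) ^ k * (of_real ((- 1) ^ j * a j) * R $ (k - j))
          = of_real (a j) * ((- 1) ^ (k - j) * R $ (k - j))"
        unfolding s by (simp add: mult_ac)
    qed simp
    finally have "of_real D * ((- 1) ^ k * R $ k)
        = (\<Sum>j=1..k. of_real (a j) * ((- 1) ^ (k - j) * R $ (k - j)))"
      by (simp only: mult.left_commute)
    then have "Re (of_real D * ((- 1) ^ k * R $ k))
        = (\<Sum>j=1..k. Re (of_real (a j) * ((- 1) ^ (k - j) * R $ (k - j))))"
      by (simp only: Re_sum)
    moreover have "Re (of_real x * z) = x * Re z" for x z by simp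
    ultimately show ?thesis by (simp only: r_def)
  qed
  have r_nonneg: "r k \<ge> 0" for k
  proof (induction k rule: less_induct)
    case (less k)
    show ?case
    proof (cases "k = 0")
      case False
      have "0 \<le> (\<Sum>j=1..k. a j * r (k - j))"
        using less a by (intro sum_nonneg mult_nonneg_nonneg) auto
      then have "D * r k \<ge> 0"
        using rec[of k] False by simp
      then show ?thesis using D by (simp add: zero_le_mult_iff)
    qed (use r0 D in simp)
  qed
  \<comment> \<open>All terms of the recursion are nonnegative, so one of them alone is a lower
    bound; applying this \<open>l\<close> times from \<open>r 0 = 1 / D\<close> yields the
    power.\<close>
  have step: "a j / D * r (k - j) \<le> r k" if k: "k \<ge> j" for k
  proof -
    have "a j * r (k - j) \<le> (\<Sum>j=1..k. a j * r (k - j))"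
      using j k a r_nonneg by (intro member_le_sum) auto
    also have "\<dots> = D * r k" using rec[of k] j k by simp
    finally show ?thesis using D by (simp add: field_simps)
  qed
  have "(a j / D) ^ l / D \<le> r (j * l)"
  proof (induction l)
    case (Suc l)
    have "(a j / D) ^ Suc l / D = a j / D * ((a j / D) ^ l / D)" by simp
    also have "\<dots> \<le> a j / D * r (j * l)"
      using Suc a[of j] D by (intro mult_left_mono) auto
    also have "\<dots> \<le> r (j * Suc l)" using step[of "j * Suc l"] by simp
    finally show ?case .
  qed (simp add: r0)
  also have "r (j * l) \<le> norm ((- 1) ^ (j * l) * R $ (j * l))"
    unfolding r_def by (rule complex_Re_le_cmod)
  also have "\<dots> = norm (R $ (j * l))" by (simp add: norm_mult norm_power)
  finally show ?thesis .
qed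

lemma inverse_closed_imp_power_bound:
  assumes M: "weight_matrix M" and \<alpha>: "\<alpha> > 1" and \<gamma>: "\<gamma> > \<alpha> - 1" and L: "log_convex_seq L"
    and p: "p > 0" and eqv: "seq_equiv (M p) (\<lambda>j. gevrey_seq \<gamma> j * L j)"
    and inv: "inverse_closed M (sector \<alpha>)"
  shows "\<exists>q>0. \<exists>D>0. \<forall>j\<ge>1. \<forall>l\<ge>1.
        check_seq (M p) j ^ l \<le> D ^ (j * l) * check_seq (M q) (j * l)"
proof -
  define S where "S = sector \<alpha>"
  have S: "open S" by (simp add: S_def open_sector)
  have in_S: "of_real x \<in> S" for x using of_real_in_sector[of \<alpha>] \<alpha> by (simp add: S_def)
  obtain f a A h c where hf: "f holomorphic_on S" and A: "A > 0" and h: "h > 0" and c: "c > 0"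
    and fb: "\<And>j w. w \<in> S \<Longrightarrow> norm ((zderiv ^^ j) f w) \<le> A * h ^ j * (gevrey_seq \<gamma> j * L j)"
    and fr: "\<And>j x. (zderiv ^^ j) f (of_real x) = of_real ((- 1) ^ j * a j x)"
    and a: "\<And>j x. a j x \<ge> 0"
    and al: "\<And>j. j \<ge> 1 \<Longrightarrow> \<exists>x. a j x \<ge> c ^ j * (gevrey_seq \<gamma> j * L j)"
    using completely_monotone_function[OF \<alpha> \<gamma> L] unfolding S_def by metis
  obtain A1 B1 where A1: "A1 > 0" and B1: "B1 > 0"
    and up: "\<And>j. M p j \<le> A1 * B1 ^ j * (gevrey_seq \<gamma> j * L j)"
    using eqv unfolding seq_equiv_def seq_preceq_def by blast
  obtain A2 B2 where A2: "A2 > 0" and B2: "B2 > 0"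
    and low: "\<And>j. gevrey_seq \<gamma> j * L j \<le> A2 * B2 ^ j * M p j"
    using eqv unfolding seq_equiv_def seq_preceq_def by blast
  have jf: "norm (jet f w $ j) \<le> (A * A2) * (h * B2) ^ j * check_seq (M p) j" if "w \<in> S" for w j
  proof -
    have "norm ((zderiv ^^ j) f w) \<le> A * h ^ j * (A2 * B2 ^ j * M p j)"
      using A h by (intro order_trans[OF fb[OF that]] mult_left_mono low) auto
    then show ?thesis
      by (simp add: jet_nth norm_divide check_seq_def power_mult_distrib divide_right_mono mult_ac)
  qed
  have f: "f \<in> ultraholo M S"
    using jf h B2 by (intro ultraholoI[OF M hf p, of "h * B2" "A * A2"]) auto
  obtain B where B: "B > 0" "\<And>w. w \<in> S \<Longrightarrow> norm (f w) \<le> B"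
    using ultraholo_bounded[OF M f] by blast
  \<comment> \<open>The margin 1 gives norm (g w) >= 1 on the sector and makes
    \<open>C - a 0 x\<close> positive at every real point.\<close>
  define C where "C = B + 1"
  define g where "g = (\<lambda>w. of_real C - f w)"
  have hg: "g holomorphic_on S" unfolding g_def by (intro holomorphic_intros hf)
  have jg: "jet g w = fps_const (of_real C) - jet f w" if "w \<in> S" for w
    unfolding g_def using jet_diff[OF _ hf S that, of "\<lambda>_. of_real C"]
      jet_const_on[OF S _ that, of "\<lambda>_. of_real C"] by simp
  have "g \<in> ultraholo M S"
  proof (rule ultraholoI[OF M hg p, of "h * B2" "C + A * A2"])
    fix w j assume w: "w \<in> S"
    have "norm (fps_const (complex_of_real C) $ j) \<le> C * (h * B2) ^ j * check_seq (M p) j"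
    proof (cases "j = 0")
      case True
      then show ?thesis using B(1) weight_matrix_0[OF M p] by (simp add: C_def check_seq_def)
    next
      case False
      then show ?thesis
        using B(1) h B2 check_seq_weight_pos[OF M p, of j] by (simp add: C_def)
    qed
    then show "norm (jet g w $ j) \<le> (C + A * A2) * (h * B2) ^ j * check_seq (M p) j"
      using jf[OF w, of j] norm_triangle_ineq4[of "fps_const (complex_of_real C) $ j" "jet f w $ j"]
      unfolding jg[OF w] fps_sub_nth distrib_right by linarith
  qed (use h B2 in auto)
  moreover have g_ge: "norm (g w) \<ge> 1" if "w \<in> S" for w
    using norm_triangle_ineq2[of "of_real C" "f w"] B(1) B(2)[OF that] by (simp add: g_def C_def)
  moreover have "(INF w\<in>S. norm (g w)) \<ge> 1"
    using g_ge in_S by (intro cINF_greatest) auto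
  ultimately have "(\<lambda>w. 1 / g w) \<in> ultraholo M S"
    using inv unfolding inverse_closed_def S_def by (meson less_le_trans zero_less_one)
  then obtain q h' A' where q: "q > 0" and h': "h' > 0" and A': "A' > 0"
    and hR: "(\<lambda>w. 1 / g w) holomorphic_on S"
    and Rb: "\<And>w j. w \<in> S \<Longrightarrow> norm (jet (\<lambda>w. 1 / g w) w $ j) \<le> A' * h' ^ j * check_seq (M q) j"
    using ultraholoE[OF M] by metis
  have main: "(c ^ j * (gevrey_seq \<gamma> j * L j) / fact j / C) ^ l / C \<le> A' * h' ^ (j * l) * check_seq (M q) (j * l)"
    if j: "j \<ge> 1" for j l
  proof -
    obtain x where x: "a j x \<ge> c ^ j * (gevrey_seq \<gamma> j * L j)" using al[OF j] by blast
    let ?w = "complex_of_real x"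
    have fx: "f ?w = of_real (a 0 x)" using fr[of 0 x] by simp
    \<comment> \<open>\<open>D\<close> is the value of \<open>g\<close> at a point that varies with
      \<open>j\<close>; since it lies between 0 and \<open>C\<close>, the constant \<open>C\<close>
      replaces it for all \<open>j\<close> at once.\<close>
    define D where "D = C - a 0 x"
    have "a 0 x \<le> B" using B(2)[OF in_S, of x] a[of 0 x] unfolding fx by simp
    then have D: "D > 0" "D \<le> C" using a[of 0 x] by (auto simp: D_def C_def)
    have "jet g ?w * jet (\<lambda>w. 1 / g w) ?w = jet (\<lambda>w. g w * (1 / g w)) ?w"
      by (rule jet_mult[OF hg hR S in_S, symmetric])
    also have "\<dots> = fps_const 1"
    proof (rule jet_const_on[OF S _ in_S])
      show "g w * (1 / g w) = 1" if "w \<in> S" for w using g_ge[OF that] by auto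
    qed
    finally have "(a j x / fact j / D) ^ l / D \<le> norm (jet (\<lambda>w. 1 / g w) ?w $ (j * l))"
      using D(1) j a
      by (intro reciprocal_coeff_lower_bound[where G = "jet g ?w" and a = "\<lambda>j. a j x / fact j"])
         (simp_all add: jg[OF in_S] jet_nth fr fx D_def)
    also have "\<dots> \<le> A' * h' ^ (j * l) * check_seq (M q) (j * l)" by (rule Rb[OF in_S])
    finally have *: "(a j x / fact j / D) ^ l / D \<le> A' * h' ^ (j * l) * check_seq (M q) (j * l)" .
    have pos: "c ^ j * (gevrey_seq \<gamma> j * L j) \<ge> 0"
      using c gevrey_seq_pos[of \<gamma> j] log_convex_seq_pos[OF L, of j] by simp
    have "(c ^ j * (gevrey_seq \<gamma> j * L j) / fact j / C) ^ l / C \<le> (a j x / fact j / D) ^ l / D"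
      using x D pos a[of j x] by (intro frac_le power_mono divide_right_mono) (auto intro: order_trans)
    with * show ?thesis by linarith
  qed
  \<comment> \<open>\<open>A1 * C\<close> and \<open>A' * C\<close> arise without exponent; as j and
    l are at least 1, they are absorbed into powers of their maximum with 1.\<close>
  define K where "K = max 1 (A' * C) * (max 1 (A1 * C) * B1 / c * h')"
  have C: "C > 0" using B by (simp add: C_def)
  have K: "K > 0" using B1 c h' by (simp add: K_def)
  have "check_seq (M p) j ^ l \<le> K ^ (j * l) * check_seq (M q) (j * l)" if jl: "j \<ge> 1" "l \<ge> 1" for j l
  proof -
    define G where "G = c ^ j * (gevrey_seq \<gamma> j * L j) / fact j / C"
    have G: "G > 0"
      using c C gevrey_seq_pos[of \<gamma> j] log_convex_seq_pos[OF L, of j] by (simp add: G_def)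
    define X where "X = max 1 (A1 * C) * B1 / c"
    have X: "X > 0" using B1 c by (simp add: X_def)
    have "check_seq (M p) j \<le> A1 * B1 ^ j * (gevrey_seq \<gamma> j * L j) / fact j"
      unfolding check_seq_def by (intro divide_right_mono up) simp
    also have "\<dots> = (A1 * C) * (B1 / c) ^ j * G"
      using c C by (simp add: G_def power_divide)
    also have "\<dots> \<le> max 1 (A1 * C) ^ j * (B1 / c) ^ j * G"
    proof (intro mult_right_mono)
      have "max 1 (A1 * C) ^ 1 \<le> max 1 (A1 * C) ^ j"
        using jl by (intro power_increasing) auto
      then show "A1 * C \<le> max 1 (A1 * C) ^ j" by simp
    qed (use B1 c G in auto)
    also have "\<dots> = X ^ j * G"
      unfolding X_def by (simp only: times_divide_eq_right[symmetric] power_mult_distrib)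
    finally have "check_seq (M p) j ^ l \<le> (X ^ j * G) ^ l"
      using check_seq_weight_pos[OF M p, of j] by (intro power_mono) auto
    also have "\<dots> = X ^ (j * l) * G ^ l" by (simp add: power_mult_distrib power_mult)
    also have "\<dots> \<le> X ^ (j * l) * ((A' * C) * (h' ^ (j * l) * check_seq (M q) (j * l)))"
      using main[OF jl(1), of l] C X unfolding G_def[symmetric]
      by (intro mult_left_mono) (auto simp: field_simps)
    also have "\<dots> \<le> X ^ (j * l) * (max 1 (A' * C) ^ (j * l) * (h' ^ (j * l) * check_seq (M q) (j * l)))"
    proof (intro mult_left_mono mult_right_mono)
      have "max 1 (A' * C) ^ 1 \<le> max 1 (A' * C) ^ (j * l)"
        using jl by (intro power_increasing) auto
      then show "A' * C \<le> max 1 (A' * C) ^ (j * l)" by simp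
    qed (use X h' check_seq_weight_pos[OF M q, of "j * l"] in auto)
    also have "\<dots> = (max 1 (A' * C) * (X * h')) ^ (j * l) * check_seq (M q) (j * l)"
      by (simp add: power_mult_distrib)
    also have "max 1 (A' * C) * (X * h') = K" by (simp add: K_def X_def)
    finally show ?thesis .
  qed
  then show ?thesis using q K by blast
qed

theorem theorem5p12:
  fixes M :: "real \<Rightarrow> nat \<Rightarrow> real" and \<alpha> :: real
  assumes "weight_matrix M"
    and "\<alpha> > 1"
    and "\<forall>p>0. \<exists>\<alpha>\<^sub>p>\<alpha>. \<exists>L. log_convex_seq L \<and>
           seq_equiv (\<lambda>j. gevrey_seq (1 - \<alpha>\<^sub>p) j * M p j) L"
  shows "(matrix_rai M \<longleftrightarrow> holomorphically_closed M (sector \<alpha>)) \<and>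
         (matrix_rai M \<longleftrightarrow> inverse_closed M (sector \<alpha>)) \<and>
         (matrix_Comega M \<and> matrix_dc M \<longrightarrow>
            (matrix_rai M \<longleftrightarrow> composition_closed M (sector \<alpha>)) \<and>
            (matrix_rai M \<longleftrightarrow> matrix_FdB M))"
proof -
  note M = assms(1) and \<alpha> = assms(2)
  \<comment> \<open>\<gamma> is alpha_p - 1: the Gevrey factor of the hypothesis is moved to the
    side of the log-convex sequence.\<close>
  have reg: "\<exists>\<gamma> L. \<gamma> > \<alpha> - 1 \<and> log_convex_seq L \<and> seq_equiv (M p) (\<lambda>j. gevrey_seq \<gamma> j * L j)"
    if p: "p > 0" for p
  proof -
    obtain \<alpha>p L where *: "\<alpha>p > \<alpha>" "log_convex_seq L"
      and "seq_equiv (\<lambda>j. gevrey_seq (1 - \<alpha>p) j * M p j) L"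
      using assms(3) p by blast
    then have "seq_equiv (\<lambda>j. gevrey_seq (- (\<alpha>p - 1)) j * M p j) L" by simp
    then show ?thesis
      using seq_equiv_gevrey * by (intro exI[of _ "\<alpha>p - 1"] exI[of _ L]) auto
  qed
  have mono: "\<exists>C>0. \<forall>j k. 1 \<le> j \<and> j \<le> k \<longrightarrow> root j (M q j) \<le> C * root k (M q k)" if q: "q > 0" for q
  proof -
    obtain \<gamma> L where *: "\<gamma> > \<alpha> - 1" "log_convex_seq L" "seq_equiv (M q) (\<lambda>j. gevrey_seq \<gamma> j * L j)"
      using reg[OF q] by blast
    have "\<gamma> \<ge> 0" using *(1) \<alpha> by simp
    then show ?thesis
      using gevrey_log_convex_root_almost_mono[OF _ *(2) weight_matrix_pos[OF M q] *(3)] by metis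
  qed
  have ab: "matrix_rai M \<Longrightarrow> holomorphically_closed M (sector \<alpha>)"
    by (rule rai_imp_holomorphically_closed[OF M open_sector])
  have bc: "holomorphically_closed M (sector \<alpha>) \<Longrightarrow> inverse_closed M (sector \<alpha>)"
    by (rule holomorphically_closed_imp_inverse_closed)
  have ca: "matrix_rai M" if "inverse_closed M (sector \<alpha>)"
  proof (rule rai_if_power_bound[OF M mono])
    fix p :: real assume p: "p > 0"
    obtain \<gamma> L where *: "\<gamma> > \<alpha> - 1" "log_convex_seq L" "seq_equiv (M p) (\<lambda>j. gevrey_seq \<gamma> j * L j)"
      using reg[OF p] by blast
    show "\<exists>q>0. \<exists>D>0. \<forall>j\<ge>1. \<forall>l\<ge>1.
        check_seq (M p) j ^ l \<le> D ^ (j * l) * check_seq (M q) (j * l)"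
      by (rule inverse_closed_imp_power_bound[OF M \<alpha> *(1,2) p *(3) that])
  qed
  have "(matrix_rai M \<longleftrightarrow> composition_closed M (sector \<alpha>)) \<and> (matrix_rai M \<longleftrightarrow> matrix_FdB M)"
    if om: "matrix_Comega M" and dc: "matrix_dc M"
  proof -
    \<comment> \<open>The circle runs (a), (e), (d), (b), (c), (a); (dc) enters in its first step
      and (C^omega) in its third.\<close>
    have "matrix_rai M \<Longrightarrow> matrix_FdB M" by (rule rai_dc_imp_FdB[OF M _ dc])
    moreover have "matrix_FdB M \<Longrightarrow> composition_closed M (sector \<alpha>)"
      by (rule FdB_imp_composition_closed[OF M open_sector])
    moreover have "composition_closed M (sector \<alpha>) \<Longrightarrow> holomorphically_closed M (sector \<alpha>)"
      by (rule composition_closed_imp_holomorphically_closed[OF M om])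
    ultimately show ?thesis using bc ca by blast
  qed
  then show ?thesis using ab bc ca by blast
qed

end
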